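(* Let $(X_i,\mathcal{F}_i)_{i\ge 0}$ be a supermartingale difference sequence, and for each $i\ge1$ let $A_i,B_i$ be $\mathcal{F}_{i-1}$-measurable real random variables such that $\mathbb{P}(A_i\le X_i\le B_i\mid\mathcal{F}_{i-1})=1$ almost surely. Then for any $x\ge 0$ and $0<v<\infty$, with $Z\sim N(0,1)$, \[ \mathbb{P}\left(\sum_{i=1}^n X_i\ge x\ \text{ and }\ \sum_{i=1}^n (B_i-A_i)^2\le 4v^2\ \text{ for some } n\ge 1\right)\le\inf_{\lambda\ge 0}\mathbb{E}\left[\left(1+\frac{\lambda}{5}(vZ-x)\right)_+^5\right]. \]
   Context: A supermartingale difference sequence $(X_i,\mathcal{F}_i)_{i\ge0}$ consists of a filtration $(\mathcal{F}_i)_{i\ge 0}$ and integrable real random variables $X_i$, with $X_0=0$, such that $X_i$ is $\mathcal{F}_i$-measurable and $\mathbb{E}[X_i\mid\mathcal{F}_{i-1}]\le 0$ almost surely for $i\ge 1$. Notation: $u_+=\max\{u,0\}$ and $u_+^{\alpha}=(u_+)^{\alpha}$. *)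

theory Defs
  imports "HOL-Probability.Probability"
begin

locale supermartingale_difference_sequence =
  prob_space M + filtration "space M" F
  for M :: "'a measure" and F :: "nat \<Rightarrow> 'a measure" +
  fixes X :: "nat \<Rightarrow> 'a \<Rightarrow> real"
  assumes sets_F_subset: "\<And>i. sets (F i) \<subseteq> sets M"
    and integrable_X: "\<And>i. integrable M (X i)"
    and X_0: "\<And>\<omega>. \<omega> \<in> space M \<Longrightarrow> X 0 \<omega> = 0"
    and adapted_X: "\<And>i. X i \<in> borel_measurable (F i)"
    and cond_exp_X_le_0:
      "\<And>i. 1 \<le> i \<Longrightarrow> AE \<omega> in M. real_cond_exp M (F (i - 1)) (X i) \<omega> \<le> 0"

text \<open>Conditional probability of an event given a sub-\<open>\<sigma>\<close>-algebra; the library's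
  \<open>cond_prob\<close> conditions on an event instead.\<close>

definition cond_prob_on :: "'a measure \<Rightarrow> 'a measure \<Rightarrow> 'a set \<Rightarrow> 'a \<Rightarrow> real" where
  "cond_prob_on M G E = real_cond_exp M G (indicat_real E)"

definition pos_part :: "real \<Rightarrow> real" where
  "pos_part u = max u 0"

end

(* Write Z for a standard normal variable, G(w, r) = E (w + r Z)_+^5, S_n = sum X_i and
   V_n = sum (B_i - A_i)^2 / 4. After rescaling X, A, B and v by l / 5 the event is contained in
   {p + S_n >= 1 and V_n <= v^2 for some n} with p = 1 - l x / 5. The process
   G(p + S_n, sqrt(v^2 - V_n)), killed once V_n exceeds v^2 (which is predictable), is a
   nonnegative supermartingale; it is at least 1 on the event by Jensen and starts at G(p, v),
   so the maximal inequality gives the bound.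

   The supermartingale property follows, through the chord of the convex function G(., r), from
   the two-point inequality
     (b (w - a)_+^5 + a (w + b)_+^5) / (a + b) <= G(w, (a + b) / 2)   (a, b >= 0)
   and the convolution identity for Gaussians. For a + b = 2 and w large the two-point inequality
   is a comparison of the moments up to order five; for w <= 2/5 the left side is controlled by
   the maximum 3125/93312 (w + 2)^6 over a of a (w + 2 - a)^5 / 2. *)

theory Submission
  imports Defs
begin

subsection \<open>Gaussian expectations of fifth powers\<close>

lemma pos_part_nonneg [simp]: "0 \<le> pos_part u"
  by (simp add: pos_part_def)

lemma pos_part_mono: "u \<le> w \<Longrightarrow> pos_part u \<le> pos_part w"
  by (auto simp: pos_part_def)

lemma borel_measurable_pos_part [measurable]: "pos_part \<in> borel_measurable borel"
  unfolding pos_part_def[abs_def] by measurable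

lemma power5_le_pos_part: "u ^ 5 \<le> pos_part u ^ 5"
proof (cases "0 \<le> u")
  case False
  then have "u ^ 5 < 0"
    by (simp add: odd_power_less_zero)
  then show ?thesis
    using zero_le_power[OF pos_part_nonneg, of u 5] by linarith
qed (simp add: pos_part_def)

text \<open>This is \<open>G\<close> of the overview, written as an integral against the density so
  that no random variable enters before the very end.\<close>

definition gauss_pos5 :: "real \<Rightarrow> real \<Rightarrow> real" where
  "gauss_pos5 w r = (\<integral>z. std_normal_density z * pos_part (w + r * z) ^ 5 \<partial>lborel)"

text \<open>Supplies the integrable majorant for \<open>gauss_pos5\<close>; the binomial expansion
  reduces it to absolute moments.\<close>

lemma integrable_std_normal_poly:
  "integrable lborel (\<lambda>z. std_normal_density z * (a + b * \<bar>z\<bar>) ^ n)"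
proof -
  have "integrable lborel
      (\<lambda>z. \<Sum>k\<le>n. (real (n choose k) * b ^ k * a ^ (n - k)) * (std_normal_density z * \<bar>z\<bar> ^ k))"
    by (intro Bochner_Integration.integrable_sum integrable_mult_right integrable_std_normal_moment_abs)
  also have "(\<lambda>z. \<Sum>k\<le>n. (real (n choose k) * b ^ k * a ^ (n - k)) * (std_normal_density z * \<bar>z\<bar> ^ k))
      = (\<lambda>z. std_normal_density z * (b * \<bar>z\<bar> + a) ^ n)"
    by (simp only: binomial_ring) (simp add: sum_distrib_left power_mult_distrib mult_ac)
  finally show ?thesis by (simp add: add.commute)
qed

lemma integrable_gauss_pos5:
  "integrable lborel (\<lambda>z. std_normal_density z * pos_part (w + r * z) ^ 5)"
proof (rule Bochner_Integration.integrable_bound[OF integrable_std_normal_poly[of "\<bar>w\<bar>" "\<bar>r\<bar>" 5]])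
  show "AE z in lborel. norm (std_normal_density z * pos_part (w + r * z) ^ 5)
      \<le> norm (std_normal_density z * (\<bar>w\<bar> + \<bar>r\<bar> * \<bar>z\<bar>) ^ 5)"
  proof (rule AE_I2)
    fix z :: real
    have "pos_part (w + r * z) \<le> \<bar>w\<bar> + \<bar>r\<bar> * \<bar>z\<bar>"
      using abs_triangle_ineq[of w "r * z"] by (auto simp: pos_part_def abs_mult)
    then have "pos_part (w + r * z) ^ 5 \<le> (\<bar>w\<bar> + \<bar>r\<bar> * \<bar>z\<bar>) ^ 5"
      by (intro power_mono) auto
    then show "norm (std_normal_density z * pos_part (w + r * z) ^ 5)
      \<le> norm (std_normal_density z * (\<bar>w\<bar> + \<bar>r\<bar> * \<bar>z\<bar>) ^ 5)"
      by (simp add: abs_mult mult_left_mono power_abs)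
  qed
qed measurable

section \<open>Moments of the normal law and lower bounds for \<open>gauss_pos5 c 1\<close>\<close>

lemma std_normal_abs_moments:
  "has_bochner_integral lborel (\<lambda>z. std_normal_density z) 1"
  "has_bochner_integral lborel (\<lambda>z. std_normal_density z * \<bar>z\<bar>) (sqrt (2 / pi))"
  "has_bochner_integral lborel (\<lambda>z. std_normal_density z * \<bar>z\<bar> ^ 2) 1"
  "has_bochner_integral lborel (\<lambda>z. std_normal_density z * \<bar>z\<bar> ^ 3) (2 * sqrt (2 / pi))"
  "has_bochner_integral lborel (\<lambda>z. std_normal_density z * \<bar>z\<bar> ^ 4) 3"
  "has_bochner_integral lborel (\<lambda>z. std_normal_density z * \<bar>z\<bar> ^ 5) (8 * sqrt (2 / pi))"
  using std_normal_moment_even[of 0] std_normal_moment_abs_odd[of 0] std_normal_moment_even[of 1]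
    std_normal_moment_abs_odd[of 1] std_normal_moment_even[of 2] std_normal_moment_abs_odd[of 2]
  by (simp_all add: eval_nat_numeral fact_numeral mult_ac)

lemma std_normal_moments:
  "has_bochner_integral lborel (\<lambda>z. std_normal_density z * z) 0"
  "has_bochner_integral lborel (\<lambda>z. std_normal_density z * z ^ 2) 1"
  "has_bochner_integral lborel (\<lambda>z. std_normal_density z * z ^ 3) 0"
  "has_bochner_integral lborel (\<lambda>z. std_normal_density z * z ^ 4) 3"
  "has_bochner_integral lborel (\<lambda>z. std_normal_density z * z ^ 5) 0"
  using std_normal_moment_odd[of 0] std_normal_moment_even[of 1]
    std_normal_moment_odd[of 1] std_normal_moment_even[of 2] std_normal_moment_odd[of 2]
  by (simp_all add: eval_nat_numeral fact_numeral mult_ac)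

text \<open>Dropping the positive part only decreases the integrand, and what remains follows from
  the moments 0, 1, 0, 3, 0. This bound serves \<open>c\<close> above 2/5.\<close>

lemma gauss_pos5_ge_poly: "c ^ 5 + 10 * c ^ 3 + 15 * c \<le> gauss_pos5 c 1"
proof -
  have "has_bochner_integral lborel
      (\<lambda>z. c ^ 5 * std_normal_density z + 5 * c ^ 4 * (std_normal_density z * z)
        + 10 * c ^ 3 * (std_normal_density z * z ^ 2) + 10 * c ^ 2 * (std_normal_density z * z ^ 3)
        + 5 * c * (std_normal_density z * z ^ 4) + std_normal_density z * z ^ 5)
      (c ^ 5 * 1 + 5 * c ^ 4 * 0 + 10 * c ^ 3 * 1 + 10 * c ^ 2 * 0 + 5 * c * 3 + 0)"
    by (intro has_bochner_integral_add has_bochner_integral_mult_right std_normal_moments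
        std_normal_abs_moments(1))
  also have "(\<lambda>z. c ^ 5 * std_normal_density z + 5 * c ^ 4 * (std_normal_density z * z)
        + 10 * c ^ 3 * (std_normal_density z * z ^ 2) + 10 * c ^ 2 * (std_normal_density z * z ^ 3)
        + 5 * c * (std_normal_density z * z ^ 4) + std_normal_density z * z ^ 5)
      = (\<lambda>z. std_normal_density z * (c + z) ^ 5)"
    by (rule ext) algebra
  finally have *: "has_bochner_integral lborel (\<lambda>z. std_normal_density z * (c + z) ^ 5)
      (c ^ 5 + 10 * c ^ 3 + 15 * c)"
    by simp
  have "(\<integral>z. std_normal_density z * (c + z) ^ 5 \<partial>lborel) \<le> gauss_pos5 c 1"
    unfolding gauss_pos5_def
    using * integrable_gauss_pos5[of c 1]
    by (intro integral_mono) (auto simp: has_bochner_integral_iff intro!: mult_left_mono power5_le_pos_part)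
  then show ?thesis
    using * by (simp add: has_bochner_integral_iff)
qed

text \<open>By symmetry in \<open>z\<close>, since \<open>pos_part (c + z) ^ 5 + pos_part (c - z) ^ 5 \<ge> (c + \<bar>z\<bar>) ^ 5\<close>.\<close>

lemma gauss_pos5_ge_abs_poly:
  "(c ^ 5 + 10 * c ^ 3 + 15 * c + sqrt (2 / pi) * (5 * c ^ 4 + 20 * c ^ 2 + 8)) / 2 \<le> gauss_pos5 c 1"
proof -
  let ?d = std_normal_density
  have "has_bochner_integral lborel
      (\<lambda>z. c ^ 5 * ?d z + 5 * c ^ 4 * (?d z * \<bar>z\<bar>)
        + 10 * c ^ 3 * (?d z * \<bar>z\<bar> ^ 2) + 10 * c ^ 2 * (?d z * \<bar>z\<bar> ^ 3)
        + 5 * c * (?d z * \<bar>z\<bar> ^ 4) + ?d z * \<bar>z\<bar> ^ 5)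
      (c ^ 5 * 1 + 5 * c ^ 4 * sqrt (2 / pi) + 10 * c ^ 3 * 1 + 10 * c ^ 2 * (2 * sqrt (2 / pi))
        + 5 * c * 3 + 8 * sqrt (2 / pi))"
    by (intro has_bochner_integral_add has_bochner_integral_mult_right std_normal_abs_moments)
  also have "(\<lambda>z. c ^ 5 * ?d z + 5 * c ^ 4 * (?d z * \<bar>z\<bar>)
        + 10 * c ^ 3 * (?d z * \<bar>z\<bar> ^ 2) + 10 * c ^ 2 * (?d z * \<bar>z\<bar> ^ 3)
        + 5 * c * (?d z * \<bar>z\<bar> ^ 4) + ?d z * \<bar>z\<bar> ^ 5)
      = (\<lambda>z. ?d z * (c + \<bar>z\<bar>) ^ 5)"
    by (rule ext) algebra
  finally have *: "has_bochner_integral lborel (\<lambda>z. ?d z * (c + \<bar>z\<bar>) ^ 5)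
      (c ^ 5 + 10 * c ^ 3 + 15 * c + sqrt (2 / pi) * (5 * c ^ 4 + 20 * c ^ 2 + 8))"
    by (simp add: algebra_simps)
  \<comment> \<open>The normal density is even, so adding the integrals for \<open>z\<close> and
    \<open>- z\<close> counts \<open>gauss_pos5 c 1\<close> twice.\<close>
  have reflect: "gauss_pos5 c 1 = gauss_pos5 c (- 1)"
    unfolding gauss_pos5_def
    by (subst lborel_integral_real_affine[of "-1" _ 0]) (simp_all add: std_normal_density_def)
  have "(\<integral>z. ?d z * (c + \<bar>z\<bar>) ^ 5 \<partial>lborel)
      \<le> (\<integral>z. ?d z * pos_part (c + 1 * z) ^ 5 + ?d z * pos_part (c + (-1) * z) ^ 5 \<partial>lborel)"
  proof (intro integral_mono Bochner_Integration.integrable_add integrable_gauss_pos5)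
    show "integrable lborel (\<lambda>z. ?d z * (c + \<bar>z\<bar>) ^ 5)"
      using * by (simp add: has_bochner_integral_iff)
    fix z :: real
    have "(c + \<bar>z\<bar>) ^ 5 \<le> pos_part (c + z) ^ 5 + pos_part (c - z) ^ 5"
      using power5_le_pos_part[of "c + \<bar>z\<bar>"]
      by (cases "0 \<le> z") (auto intro: add_increasing add_increasing2)
    then show "?d z * (c + \<bar>z\<bar>) ^ 5 \<le> ?d z * pos_part (c + 1 * z) ^ 5 + ?d z * pos_part (c + (-1) * z) ^ 5"
      unfolding distrib_left[symmetric] by (intro mult_left_mono) auto
  qed
  also have "\<dots> = 2 * gauss_pos5 c 1"
    using reflect integrable_gauss_pos5[of c 1] integrable_gauss_pos5[of c "-1"]
    by (subst Bochner_Integration.integral_add) (simp_all add: gauss_pos5_def)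
  finally show ?thesis
    using * by (simp add: has_bochner_integral_iff)
qed

text \<open>\<open>- std_normal_density\<close> is an antiderivative of the integrand and vanishes
  at infinity; \<open>0 \<le> t\<close> keeps the integrand nonnegative.\<close>

lemma has_bochner_integral_std_normal_tail:
  "has_bochner_integral lborel (\<lambda>z. indicator {t..} z * (z * std_normal_density z)) (std_normal_density t)"
  if "0 \<le> t"
proof (rule has_bochner_integral_nn_integral)
  have "((\<lambda>z::real. - std_normal_density z) \<longlongrightarrow> 0) at_top"
    unfolding std_normal_density_def by real_asymp
  then have "(\<integral>\<^sup>+z. ennreal (z * std_normal_density z) * indicator {t..} z \<partial>lborel)
      = ennreal (0 - (- std_normal_density t))"
    using that unfolding std_normal_density_def
    by (intro nn_integral_FTC_atLeast) (auto intro!: derivative_eq_intros simp: field_simps)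
  moreover have "ennreal (indicator {t..} z * (z * std_normal_density z))
      = ennreal (z * std_normal_density z) * indicator {t..} z" for z
    by (simp add: indicator_def)
  ultimately show "(\<integral>\<^sup>+z. ennreal (indicator {t..} z * (z * std_normal_density z)) \<partial>lborel)
      = ennreal (std_normal_density t)"
    by simp
qed (use that in \<open>auto simp: indicator_def\<close>)

text \<open>Since \<open>c \<le> 0\<close>, the ratio \<open>(c + z) / z\<close> is nondecreasing,
  so \<open>c + z\<close> is at least \<open>z / t * (c + t)\<close> beyond \<open>t\<close>.
  Lowering the fifth power of \<open>z / t\<close> to the first leaves an integrand with an explicit
  antiderivative.\<close>

lemma gauss_pos5_ge_tail:
  assumes "0 < t" "0 \<le> c + t" "c \<le> 0"
  shows "(c + t) ^ 5 / t * std_normal_density t \<le> gauss_pos5 c 1"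
proof -
  let ?d = std_normal_density
  have I: "has_bochner_integral lborel
      (\<lambda>z. (c + t) ^ 5 / t * (indicator {t..} z * (z * ?d z))) ((c + t) ^ 5 / t * ?d t)"
    using assms by (intro has_bochner_integral_mult_right has_bochner_integral_std_normal_tail) auto
  have "(c + t) ^ 5 / t * (indicator {t..} z * (z * ?d z)) \<le> ?d z * pos_part (c + 1 * z) ^ 5" for z
  proof (cases "t \<le> z")
    case True
    have "z * (c + t) \<le> t * (c + z)"
      using True assms mult_left_mono_neg[of t z c] by (simp add: algebra_simps)
    then have "z / t * (c + t) \<le> c + z"
      using assms by (simp add: field_simps)
    moreover have "1 \<le> z / t"
      using True assms by simp
    ultimately have *: "(z / t) ^ 5 * (c + t) ^ 5 \<le> (c + z) ^ 5" and "(z / t) ^ 1 \<le> (z / t) ^ 5"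
      unfolding power_mult_distrib[symmetric] using assms
      by (intro power_mono power_increasing; simp)+
    then have "z / t * (c + t) ^ 5 \<le> (z / t) ^ 5 * (c + t) ^ 5"
      unfolding power_one_right using assms by (intro mult_right_mono zero_le_power)
    also note *
    finally have "z / t * (c + t) ^ 5 \<le> (c + z) ^ 5" .
    moreover have "pos_part (c + z) = c + z"
      using True assms by (simp add: pos_part_def)
    ultimately have "?d z * (z / t * (c + t) ^ 5) \<le> ?d z * pos_part (c + z) ^ 5"
      by (intro mult_left_mono) simp_all
    moreover have "(c + t) ^ 5 / t * (indicator {t..} z * (z * ?d z)) = ?d z * (z / t * (c + t) ^ 5)"
      using True by (simp add: indicator_def)
    ultimately show ?thesis by (simp only: mult_1)
  qed (simp add: indicator_def)
  then have "(\<integral>z. (c + t) ^ 5 / t * (indicator {t..} z * (z * ?d z)) \<partial>lborel) \<le> gauss_pos5 c 1"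
    unfolding gauss_pos5_def
    using I integrable_gauss_pos5[of c 1] by (intro integral_mono) (simp_all only: has_bochner_integral_iff)
  then show ?thesis
    using I by (simp only: has_bochner_integral_iff)
qed

section \<open>Measurability, monotonicity, homogeneity and convexity of
  \<open>gauss_pos5\<close>\<close>

lemma borel_measurable_gauss_pos5 [measurable (raw)]:
  assumes [measurable]: "f \<in> borel_measurable M" "g \<in> borel_measurable M"
  shows "(\<lambda>x. gauss_pos5 (f x) (g x)) \<in> borel_measurable M"
  unfolding gauss_pos5_def by measurable

lemma gauss_pos5_nonneg: "0 \<le> gauss_pos5 w r"
  unfolding gauss_pos5_def by (intro Bochner_Integration.integral_nonneg) simp

lemma gauss_pos5_0: "gauss_pos5 w 0 = pos_part w ^ 5"
  by (simp add: gauss_pos5_def)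

lemma gauss_pos5_mono_left: "w \<le> w' \<Longrightarrow> gauss_pos5 w r \<le> gauss_pos5 w' r"
  unfolding gauss_pos5_def
  by (intro integral_mono integrable_gauss_pos5 mult_left_mono power_mono pos_part_mono) auto

lemma pos_part_mult: "0 \<le> a \<Longrightarrow> pos_part (a * u) = a * pos_part u"
  by (cases "0 \<le> u") (simp_all add: pos_part_def max_absorb1 max_absorb2 mult_nonneg_nonpos)

lemma gauss_pos5_scale: "0 \<le> a \<Longrightarrow> gauss_pos5 (a * w) (a * r) = a ^ 5 * gauss_pos5 w r"
proof -
  assume "0 \<le> a"
  then have "pos_part (a * w + a * r * z) = a * pos_part (w + r * z)" for z
    using pos_part_mult[of a "w + r * z"] by (simp add: distrib_left mult.assoc)
  then have "std_normal_density z * pos_part (a * w + a * r * z) ^ 5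
      = a ^ 5 * (std_normal_density z * pos_part (w + r * z) ^ 5)" for z
    by (simp add: power_mult_distrib)
  then show ?thesis
    unfolding gauss_pos5_def by (simp only: integral_mult_right_zero)
qed

lemma convex_on_pos_part_power5: "convex_on UNIV (\<lambda>u. pos_part u ^ 5)"
proof (rule convex_onI)
  fix t x y :: real
  assume t: "0 < t" "t < 1"
  have *: "pos_part ((1 - t) * x + t * y) \<le> (1 - t) * pos_part x + t * pos_part y"
    using t pos_part_mult[of t y] pos_part_mult[of "1 - t" x] unfolding pos_part_def by linarith
  have "pos_part ((1 - t) * x + t * y) ^ 5 \<le> ((1 - t) * pos_part x + t * pos_part y) ^ 5"
    by (intro power_mono *) simp
  also have "\<dots> \<le> (1 - t) * pos_part x ^ 5 + t * pos_part y ^ 5"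
    using convex_onD[OF convex_power_odd[of 5], of t "pos_part x" "pos_part y"] t by simp
  finally show "pos_part ((1 - t) *\<^sub>R x + t *\<^sub>R y) ^ 5 \<le> (1 - t) * pos_part x ^ 5 + t * pos_part y ^ 5"
    by simp
qed simp

lemma convex_on_gauss_pos5: "convex_on UNIV (\<lambda>w. gauss_pos5 w r)"
proof (rule convex_onI)
  fix t x y :: real
  assume t: "0 < t" "t < 1"
  have "gauss_pos5 ((1 - t) * x + t * y) r \<le>
    (\<integral>z. (1 - t) * (std_normal_density z * pos_part (x + r * z) ^ 5)
      + t * (std_normal_density z * pos_part (y + r * z) ^ 5) \<partial>lborel)"
    unfolding gauss_pos5_def
  proof (intro integral_mono Bochner_Integration.integrable_add integrable_mult_right integrable_gauss_pos5)
    fix z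
    have "pos_part ((1 - t) * x + t * y + r * z) ^ 5
        \<le> (1 - t) * pos_part (x + r * z) ^ 5 + t * pos_part (y + r * z) ^ 5"
      using convex_onD[OF convex_on_pos_part_power5, of t "x + r * z" "y + r * z"] t
      by (simp add: algebra_simps)
    from mult_left_mono[OF this, of "std_normal_density z"]
    show "std_normal_density z * pos_part ((1 - t) * x + t * y + r * z) ^ 5
      \<le> (1 - t) * (std_normal_density z * pos_part (x + r * z) ^ 5)
      + t * (std_normal_density z * pos_part (y + r * z) ^ 5)"
      by (simp add: algebra_simps)
  qed
  also have "\<dots> = (1 - t) * gauss_pos5 x r + t * gauss_pos5 y r"
    using integrable_gauss_pos5[of x r] integrable_gauss_pos5[of y r]
    by (subst Bochner_Integration.integral_add) (simp_all add: gauss_pos5_def)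
  finally show "gauss_pos5 ((1 - t) *\<^sub>R x + t *\<^sub>R y) r \<le> (1 - t) * gauss_pos5 x r + t * gauss_pos5 y r"
    by simp
qed simp

section \<open>Convolution of Gaussians\<close>

lemma nn_integral_std_normal_affine:
  assumes "0 < r" and [measurable]: "h \<in> borel_measurable borel"
  shows "(\<integral>\<^sup>+z. ennreal (std_normal_density z) * h (r * z) \<partial>lborel)
    = (\<integral>\<^sup>+y. ennreal (normal_density 0 r y) * h y \<partial>lborel)"
proof -
  have eq: "r * normal_density 0 r (r * z) = std_normal_density z" for z
  proof -
    have "- (r * z - 0)\<^sup>2 / (2 * r\<^sup>2) = - z\<^sup>2 / 2" "sqrt (2 * pi * r\<^sup>2) = sqrt (2 * pi) * r"
      using assms by (simp_all add: power_mult_distrib real_sqrt_mult)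
    then show ?thesis
      using assms by (simp add: normal_density_def)
  qed
  have "(\<integral>\<^sup>+y. ennreal (normal_density 0 r y) * h y \<partial>lborel)
      = ennreal \<bar>r\<bar> * (\<integral>\<^sup>+z. ennreal (normal_density 0 r (0 + r * z)) * h (0 + r * z) \<partial>lborel)"
    using assms by (intro nn_integral_real_affine) auto
  also have "\<dots> = (\<integral>\<^sup>+z. ennreal r * (ennreal (normal_density 0 r (r * z)) * h (r * z)) \<partial>lborel)"
    using assms by (subst nn_integral_cmult) auto
  also have "\<dots> = (\<integral>\<^sup>+z. ennreal (std_normal_density z) * h (r * z) \<partial>lborel)"
    unfolding mult.assoc[symmetric] using assms by (simp add: ennreal_mult'[symmetric] eq)
  finally show ?thesis ..
qed

text \<open>For independent standard normal Z and Z', the sum r Z + s Z' is normal with variance r^2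
  + s^2. The value \<open>r = 0\<close> is treated separately, as r Z then has no density.\<close>

lemma has_bochner_integral_gauss_pos5:
  assumes "0 \<le> r" "0 < s"
  shows "has_bochner_integral lborel (\<lambda>z. std_normal_density z * gauss_pos5 (w + r * z) s)
    (gauss_pos5 w (sqrt (r\<^sup>2 + s\<^sup>2)))"
proof (cases "r = 0")
  case True
  then show ?thesis
    using has_bochner_integral_mult_left[OF std_normal_abs_moments(1), of "gauss_pos5 w s"] assms by simp
next
  case False
  then have r: "0 < r" using assms by simp
  \<comment> \<open>Nonnegative integrals allow Fubini without any integrability condition.\<close>
  have nn: "ennreal (gauss_pos5 u q) = (\<integral>\<^sup>+z. ennreal (std_normal_density z) * ennreal (pos_part (u + q * z) ^ 5) \<partial>lborel)" for u q
    unfolding gauss_pos5_def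
    by (subst nn_integral_eq_integral[symmetric, OF integrable_gauss_pos5]) (simp_all add: ennreal_mult')
  show ?thesis
  proof (rule has_bochner_integral_nn_integral)
    let ?h = "\<lambda>y. ennreal (pos_part (w + y) ^ 5)"
    let ?n = "\<lambda>q y. ennreal (normal_density 0 q y)"
    have "(\<integral>\<^sup>+z. ennreal (std_normal_density z * gauss_pos5 (w + r * z) s) \<partial>lborel)
        = (\<integral>\<^sup>+z. ennreal (std_normal_density z) * ennreal (gauss_pos5 (w + r * z) s) \<partial>lborel)"
      by (simp add: ennreal_mult')
    also have "\<dots> = (\<integral>\<^sup>+y. ?n r y * ennreal (gauss_pos5 (w + y) s) \<partial>lborel)"
      by (rule nn_integral_std_normal_affine[OF r]) measurable
    also have "\<dots> = (\<integral>\<^sup>+y. ?n r y * (\<integral>\<^sup>+u. ?n s u * ?h (y + u) \<partial>lborel) \<partial>lborel)"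
      unfolding nn using nn_integral_std_normal_affine[OF assms(2), of "\<lambda>u. ennreal (pos_part (w + y + u) ^ 5)" for y]
      by (simp add: add.assoc)
    \<comment> \<open>The shift is moved from \<open>?h\<close> to the density, so that after Fubini
      \<open>?h u\<close> factors out and a convolution of two densities remains.\<close>
    also have "\<dots> = (\<integral>\<^sup>+y. ?n r y * (\<integral>\<^sup>+u. ?n s (u - y) * ?h u \<partial>lborel) \<partial>lborel)"
    proof -
      have "(\<integral>\<^sup>+u. ?n s u * ?h (y + u) \<partial>lborel) = (\<integral>\<^sup>+u. ?n s (u - y) * ?h u \<partial>lborel)" for y
        by (subst (2) nn_integral_real_affine[of _ 1 y]) simp_all
      then show ?thesis by simp
    qed
    also have "\<dots> = (\<integral>\<^sup>+y. \<integral>\<^sup>+u. ?n r y * (?n s (u - y) * ?h u) \<partial>lborel \<partial>lborel)"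
      by (simp add: nn_integral_cmult)
    also have "\<dots> = (\<integral>\<^sup>+u. \<integral>\<^sup>+y. ?n r y * (?n s (u - y) * ?h u) \<partial>lborel \<partial>lborel)"
      by (rule lborel_pair.Fubini') measurable
    also have "\<dots> = (\<integral>\<^sup>+u. (\<integral>\<^sup>+y. ennreal (normal_density 0 s (u - y) * normal_density 0 r y) \<partial>lborel) * ?h u \<partial>lborel)"
    proof (intro nn_integral_cong)
      fix u :: real
      have "?n r y * (?n s (u - y) * ?h u) = ennreal (normal_density 0 s (u - y) * normal_density 0 r y) * ?h u" for y
        by (simp add: ennreal_mult mult.assoc mult.left_commute)
      then show "(\<integral>\<^sup>+y. ?n r y * (?n s (u - y) * ?h u) \<partial>lborel)
          = (\<integral>\<^sup>+y. ennreal (normal_density 0 s (u - y) * normal_density 0 r y) \<partial>lborel) * ?h u"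
        by (subst nn_integral_multc[symmetric]) simp_all
    qed
    also have "\<dots> = (\<integral>\<^sup>+u. ?n (sqrt (s\<^sup>2 + r\<^sup>2)) u * ?h u \<partial>lborel)"
      using fun_cong[OF conv_normal_density_zero_mean[OF assms(2) r]] by simp
    also have "\<dots> = ennreal (gauss_pos5 w (sqrt (r\<^sup>2 + s\<^sup>2)))"
      unfolding nn
      by (subst nn_integral_std_normal_affine[symmetric]) (use r in \<open>simp_all add: add_pos_nonneg add.commute\<close>)
    finally show "(\<integral>\<^sup>+z. ennreal (std_normal_density z * gauss_pos5 (w + r * z) s) \<partial>lborel)
      = ennreal (gauss_pos5 w (sqrt (r\<^sup>2 + s\<^sup>2)))" .
  qed (simp_all add: gauss_pos5_nonneg)
qed

subsection \<open>Polynomial inequalities\<close>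

text \<open>If pi / 6 were at least 0.526, then sin 0.526 would be at most 1/2, which the cubic
  Taylor polynomial with its error bound refutes. The constant is just small enough for 0.796 in
  \<open>sqrt_2_over_pi_ge\<close>.\<close>

lemma pi_less: "pi < 3.156"
proof (rule ccontr)
  assume "\<not> pi < 3.156"
  then have "sin (0.526 :: real) \<le> sin (pi / 6)"
    by (intro sin_monotone_2pi_le) auto
  then have "sin (0.526 :: real) \<le> 1 / 2"
    by (simp add: sin_30)
  moreover have "\<bar>sin (0.526 :: real) - (\<Sum>m<5. sin_coeff m * 0.526 ^ m)\<bar> \<le> inverse (fact 5) * \<bar>0.526\<bar> ^ 5"
    by (rule Maclaurin_sin_bound)
  moreover have "{..<5::nat} = {0, 1, 2, 3, 4}"
    by auto
  ultimately show False
    by (simp add: sin_coeff_def fact_numeral power_divide divide_simps abs_le_iff)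
qed

lemma sqrt_2_over_pi_ge: "0.796 \<le> sqrt (2 / pi)"
proof (rule real_le_rsqrt)
  show "0.796\<^sup>2 \<le> 2 / pi"
    using pi_less by (simp add: field_simps power2_eq_square)
qed

text \<open>This is the expression of \<open>moment_gap_nonneg\<close> at \<open>c = 2/5\<close>.
  Its derivative vanishes at \<open>e = 3/5\<close>; it is a positive constant plus a nonnegative
  combination of the four terms below, all of which vanish there.\<close>

lemma quintic_nonneg:
  fixes e :: real assumes "0 \<le> e"
  shows "0 \<le> 4 - 36/5 * e - 84/25 * e^2 + 16/5 * e^3 + 6 * e^4 + 4 * e^5"
proof -
  have "0 \<le> e * (e - 3/5)^2" "0 \<le> (e^2 - 9/25)^2" "0 \<le> e * (e^2 - 9/25)^2" "0 \<le> (e - 3/5)^2"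
    using assms by auto
  then show ?thesis
    by (simp add: power2_eq_square eval_nat_numeral algebra_simps)
qed

text \<open>With \<open>a = 1 - e\<close> and \<open>b = 1 + e\<close> this is \<open>c ^ 5 + 10 * c ^ 3 + 15 * c\<close> minus
  \<open>(b * (c - a) ^ 5 + a * (c + b) ^ 5) / 2\<close>. For \<open>e * c \<le> 1/3\<close> it increases in \<open>c\<close>; otherwise it
  becomes, after multiplication by \<open>e\<close>, nearly a quadratic in \<open>e\<^sup>2\<close> with negative discriminant.\<close>

lemma moment_gap_nonneg:
  fixes c e :: real
  assumes "2/5 \<le> c" "0 \<le> e" "e \<le> 1"
  shows "0 \<le> 10*c*(1 - e*c)^2 + 20*e^3*c^2 - (10*e^2 - 15*e^4)*c - 4*e + 4*e^5"
proof (cases "e * c \<le> 1/3")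
  case True
  \<comment> \<open>The difference quotient of the expression between 2/5 and \<open>c\<close> is a
    polynomial in \<open>t\<close>, \<open>e * (2/5)\<close> and \<open>e\<close>, where
    \<open>u\<close> is the sum of the first two. It is shown to be nonnegative.\<close>
  define t u where "t = e * c" and "u = e * c + e * (2/5)"
  have t: "0 \<le> t" "t \<le> 1/3" "0 \<le> e * (2/5)" using assms True
    unfolding t_def by auto
  have "e * (2/5) \<le> t"
    unfolding t_def by (rule mult_left_mono[OF assms(1,2)])
  with t have u: "0 \<le> u" "u \<le> 2/3" unfolding u_def t_def by auto
  have E: "0 \<le> 1 - e^2" "e^2 \<ge> 0" using assms by (auto simp: power_le_one)
  have q: "t^2 + t * (e * (2/5)) + (e * (2/5))^2 \<ge> 3/4 * u^2"
  proof -
    have "t^2 + t * (e * (2/5)) + (e * (2/5))^2 - 3/4 * u^2 = (t - e * (2/5))^2 / 4"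
      by (simp add: u_def t_def field_simps power2_eq_square)
    moreover have "0 \<le> (t - e * (2/5))^2 / 4" by simp
    ultimately show ?thesis by linarith
  qed
  \<comment> \<open>The threshold 1/3 for \<open>e * c\<close> enters here: it gives
    \<open>u \<le> 2/3\<close>, the smaller root of the difference.\<close>
  have "10 * (2 * u - 1) \<le> 15/2 * u^2"
  proof -
    have "15/2 * u^2 - 10 * (2 * u - 1) = 5/2 * ((2 - 3 * u) * (2 - u))"
      by (simp add: field_simps power2_eq_square)
    moreover have "0 \<le> (2 - 3 * u) * (2 - u)" using u by simp
    ultimately show ?thesis by linarith
  qed
  then have "(1 - e^2) * (10 * (2 * u - 1)) \<le> (1 - e^2) * (15/2 * u^2)"
    using E by (intro mult_left_mono)
  also have "\<dots> \<le> 15/2 * u^2"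
    using E by (simp add: algebra_simps)
  finally have Q1: "(1 - e^2) * (10 * (2 * u - 1)) \<le> 15/2 * u^2" .
  have Q: "0 \<le> 10 * (t^2 + t * (e * (2/5)) + (e * (2/5))^2) + 10 * (1 - e^2) * (1 - 2 * u) + 15 * e^4"
  proof -
    define T Y where "T = t^2 + t * (e * (2/5)) + (e * (2/5))^2" and "Y = (1 - e^2) * (10 * (2 * u - 1))"
    have "0 \<le> 15 * e^4" by simp
    moreover have "10 * (1 - e^2) * (1 - 2 * u) = - Y"
      by (simp add: Y_def algebra_simps)
    moreover have "Y \<le> 10 * T"
      using q Q1 unfolding T_def[symmetric] Y_def[symmetric] by linarith
    ultimately show ?thesis unfolding T_def[symmetric] by linarith
  qed
  then have "0 \<le> (c - 2/5) * (10 * (t^2 + t * (e * (2/5)) + (e * (2/5))^2) + 10 * (1 - e^2) * (1 - 2 * u) + 15 * e^4)"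
    using assms by simp
  moreover have "10*c*(1 - e*c)^2 + 20*e^3*c^2 - (10*e^2 - 15*e^4)*c - 4*e + 4*e^5
     = (c - 2/5) * (10 * (t^2 + t * (e * (2/5)) + (e * (2/5))^2) + 10 * (1 - e^2) * (1 - 2 * u) + 15 * e^4)
       + (4 - 36/5 * e - 84/25 * e^2 + 16/5 * e^3 + 6 * e^4 + 4 * e^5)"
    unfolding t_def u_def by (simp add: field_simps eval_nat_numeral)
  ultimately show ?thesis
    using quintic_nonneg[OF assms(2)] by linarith
next
  case False
  define t where "t = e * c"
  have t: "1/3 < t" using False by (simp add: t_def)
  have e: "0 < e" using t assms(2) unfolding t_def by (cases "e = 0") auto
  define E where "E = e^2"
  have R: "0 \<le> 15 * t * E^2 + (20 * t^2 - 10 * t - 4) * E + 10 * t * (1 - t)^2"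
  proof (cases "t \<le> 1")
    case True
    \<comment> \<open>The linear coefficient in \<open>E\<close> is split as
      \<open>- 24 * t * (1 - t)\<close> plus \<open>14 * t - 4 * t^2 - 4\<close>. The first part is
      absorbed by this completed square, the second is nonnegative for \<open>t\<close> between 1/3
      and 1.\<close>
    have "0 \<le> 15 * (E - 4/5 * (1 - t))^2 + 2/5 * (1 - t)^2" by simp
    then have "0 \<le> t * (15 * E^2 + 10 * (1 - t)^2 - 24 * E * (1 - t))"
      using t by (intro mult_nonneg_nonneg) (simp_all add: field_simps power2_eq_square)
    moreover have "0 \<le> E * (14 * t - 4 * t^2 - 4)"
    proof -
      have "0 \<le> (t - 1/3) * (1 - t)" using True t by simp
      then show ?thesis using t unfolding E_def
        by (intro mult_nonneg_nonneg) (simp_all add: field_simps power2_eq_square)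
    qed
    ultimately show ?thesis by (simp add: algebra_simps power2_eq_square)
  next
    case False
    then have t1: "1 < t" by simp
    then have "t \<le> t\<^sup>2" using self_le_power[of t 2] by simp
    with t1 have "0 \<le> 20 * t^2 - 10 * t - 4" by linarith
    then show ?thesis using t1 by (simp add: E_def)
  qed
  have "e * (10*c*(1 - e*c)^2 + 20*e^3*c^2 - (10*e^2 - 15*e^4)*c - 4*e + 4*e^5)
    = 15 * t * E^2 + (20 * t^2 - 10 * t - 4) * E + 10 * t * (1 - t)^2 + 4 * e^6"
    unfolding t_def E_def by (simp add: field_simps eval_nat_numeral)
  also have "\<dots> \<ge> 0" using R by simp
  finally show ?thesis using e by (simp add: zero_le_mult_iff)
qed

text \<open>The maximum is attained at \<open>y = 5/6\<close>, hence the double factor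
  \<open>(6/5*y - 1)^2\<close>; its cofactor has positive coefficients.\<close>

lemma one_minus_mult_power5_le: fixes y :: real assumes "0 \<le> y" shows "(1 - y) * y^5 \<le> 3125/46656"
proof -
  have "3125/46656 - (1 - y) * y^5 = 
     3125/46656 * ((6/5*y - 1)^2 * (5*(6/5*y)^4 + 4*(6/5*y)^3 + 3*(6/5*y)^2 + 2*(6/5*y) + 1))"
    by (simp add: field_simps eval_nat_numeral)
  moreover have "0 \<le> (6/5*y - 1)^2 * (5*(6/5*y)^4 + 4*(6/5*y)^3 + 3*(6/5*y)^2 + 2*(6/5*y) + 1)"
    using assms by simp
  ultimately show ?thesis by linarith
qed

text \<open>Serves \<open>c\<close> from -1 to 2/5 in \<open>two_point_std\<close>, with
  \<open>s\<close> the value \<open>sqrt (2 / pi)\<close>. The extra 1/20 pays for the term with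
  \<open>pos_part (c - a)\<close>.\<close>

lemma power6_le_abs_poly: fixes c s :: real assumes "-1 \<le> c" "c \<le> 2/5" "0.796 \<le> s"
  shows "3125/93312 * (c + 2)^6 + 1/20 \<le> (c ^ 5 + 10 * c ^ 3 + 15 * c + s * (5 * c ^ 4 + 20 * c ^ 2 + 8)) / 2"
proof -
  define y where "y = c + 1"
  have y: "0 \<le> y" "y \<le> 7/5" using assms by (auto simp: y_def)
  \<comment> \<open>With \<open>s\<close> lowered to 0.796, the gap is expanded at
    \<open>c = -1\<close>. Apart from a constant above 1/20 it splits into three pieces, each
    nonnegative for \<open>y\<close> in [0, 7/5].\<close>
  define T1 where "T1 = y * (357331/388800 - 93677/155520 * y)"
  define T2 where "T2 = y^3 * (799103/583200 - 787201/777600 * y + 23531/93312 * y^2)"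
  define T3 where "T3 = 3125/93312 * (y^5 * (7/5 - y))"
  have "0 \<le> T1" using y by (simp add: T1_def)
  moreover have "0 \<le> T2"
  proof -
    have "0 \<le> (y - 2)^2" by simp
    then show ?thesis
      using y unfolding T2_def by (intro mult_nonneg_nonneg) (simp_all add: power2_eq_square algebra_simps)
  qed
  moreover have "0 \<le> T3" using y by (simp add: T3_def)
  moreover have "(c ^ 5 + 10 * c ^ 3 + 15 * c + 199/250 * (5 * c ^ 4 + 20 * c ^ 2 + 8)) / 2 - 3125/93312 * (c + 2)^6
      = 1172351/11664000 + T1 + T2 + T3"
    unfolding T1_def T2_def T3_def y_def by (simp add: field_simps eval_nat_numeral)
  moreover have "199/250 * (5 * c ^ 4 + 20 * c ^ 2 + 8) \<le> s * (5 * c ^ 4 + 20 * c ^ 2 + 8)"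
    using assms by (intro mult_right_mono) auto
  ultimately show ?thesis by argo
qed

subsection \<open>The two-point inequality\<close>

lemma gauss_pos5_ge_power6:
  assumes "-2 \<le> c" "c \<le> -1"
  shows "3125/93312 * (c + 2) ^ 6 \<le> gauss_pos5 c 1"
proof -
  define w where "w = c + 2"
  have w: "0 \<le> w" "w \<le> 1" using assms by (auto simp: w_def)
  \<comment> \<open>The exponent of the density at 12/5 is -2.88, so a lower bound for exp (-3)
    suffices.\<close>
  have "exp (3::real) = exp 1 ^ 3"
    by (simp add: exp_of_nat_mult[symmetric])
  also have "\<dots> \<le> 2.72 ^ 3"
    using e_less_272 by (intro power_mono) auto
  finally have "1 / 20.13 \<le> exp (-3::real)"
    by (simp add: exp_minus field_simps)
  also have "\<dots> \<le> exp (-(12/5)\<^sup>2 / 2)"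
    by (simp add: power2_eq_square)
  finally have "1 / 20.13 \<le> exp (-(12/5)\<^sup>2 / 2 :: real)" .
  moreover have "0.398 \<le> 1 / sqrt (2 * pi)"
  proof -
    have "1 / sqrt (2 * pi) = sqrt (2 / pi) / 2"
      by (simp add: real_sqrt_divide real_sqrt_mult field_simps)
    then show ?thesis using sqrt_2_over_pi_ge by simp
  qed
  ultimately have "0.398 * (1 / 20.13) \<le> std_normal_density (12/5)"
    unfolding std_normal_density_def by (intro mult_mono) auto
  then have d: "0.0197 \<le> std_normal_density (12/5)"
    by simp
  have "3125/93312 * w ^ 6 \<le> 3125/93312 * w ^ 5"
    using w power_decreasing[of 5 6 w] by simp
  also have "\<dots> \<le> 0.0197 * (5/12) * (7/5) ^ 5 * w ^ 5"
    using w by (intro mult_right_mono) (auto simp: field_simps)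
  also have "\<dots> = 0.0197 * (5/12) * (7/5 * w) ^ 5"
    by (simp only: power_mult_distrib mult.assoc)
  \<comment> \<open>Since \<open>w \<le> 1\<close>, \<open>7/5 * w\<close> is at most
    \<open>w + 2/5\<close>, which is \<open>c + 12/5\<close>; this leads to the tail bound at
    \<open>t = 12/5\<close>.\<close>
  also have "\<dots> \<le> 0.0197 * (5/12) * (c + 12/5) ^ 5"
    using w unfolding w_def by (intro mult_left_mono power_mono) auto
  also have "\<dots> \<le> std_normal_density (12/5) * (5/12) * (c + 12/5) ^ 5"
    using d assms by (intro mult_right_mono) auto
  also have "\<dots> = (c + 12/5) ^ 5 / (12/5) * std_normal_density (12/5)"
    by simp
  also have "\<dots> \<le> gauss_pos5 c 1"
    using assms by (intro gauss_pos5_ge_tail) auto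
  finally show ?thesis by (simp add: w_def)
qed

text \<open>The lower bound for \<open>gauss_pos5 c 1\<close> is chosen by the position of
  \<open>c\<close>: the tail bound below -1, the symmetrised moments up to 2/5, the plain moments
  beyond.\<close>

lemma two_point_std:
  assumes a: "0 \<le> a" and b: "0 \<le> b" and ab: "a + b = 2"
  shows "b * pos_part (c - a) ^ 5 + a * pos_part (c + b) ^ 5 \<le> 2 * gauss_pos5 c 1"
proof -
  \<comment> \<open>The factors \<open>a\<close> and \<open>c + b\<close> add up to
    \<open>c + 2\<close>, so with \<open>y\<close> the share of the second the product is
    \<open>(c + 2) ^ 6 * ((1 - y) * y ^ 5)\<close>.\<close>
  have key: "a * pos_part (c + b) ^ 5 \<le> 3125/46656 * (c + 2) ^ 6" if "- b < c"
  proof -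
    define w y where "w = c + 2" and "y = (c + b) / (c + 2)"
    have w: "0 < w" using that ab a by (simp add: w_def)
    have y: "c + b = w * y" "0 \<le> y" using w that by (auto simp: w_def y_def)
    have "a = w * (1 - y)" using y ab by (simp add: w_def algebra_simps)
    then have "a * (c + b) ^ 5 = w ^ 6 * ((1 - y) * y ^ 5)"
      using y by (simp add: power_mult_distrib eval_nat_numeral)
    also have "\<dots> \<le> w ^ 6 * (3125/46656)"
      using y by (intro mult_left_mono one_minus_mult_power5_le) auto
    finally show ?thesis using that by (simp add: w_def pos_part_def)
  qed
  consider "c \<le> - b" | "- b < c" "c < -1" | "- b < c" "-1 \<le> c" "c \<le> 2/5" 
    | "2/5 < c" "c \<le> a" | "2/5 < c" "a < c" by linarith
  then show ?thesis
  proof cases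
    case 1
    then have "pos_part (c - a) = 0" "pos_part (c + b) = 0" using a b by (auto simp: pos_part_def)
    then show ?thesis by (simp add: gauss_pos5_nonneg)
  next
    case 2
    have "pos_part (c - a) = 0" using 2 a by (auto simp: pos_part_def)
    moreover have "a * pos_part (c + b) ^ 5 \<le> 2 * gauss_pos5 c 1"
      using key gauss_pos5_ge_power6[of c] 2 b ab a by auto
    ultimately show ?thesis by simp
  next
    case 3
    have "pos_part (c - a) \<le> 2/5"
      using 3 a unfolding pos_part_def by linarith
    then have "b * pos_part (c - a) ^ 5 \<le> 2 * (2/5) ^ 5"
      using a b ab by (intro mult_mono power_mono) auto
    also have "\<dots> \<le> 1/10" by (simp add: power_divide)
    finally have "b * pos_part (c - a) ^ 5 + a * pos_part (c + b) ^ 5 \<le> 1/10 + 3125/46656 * (c + 2) ^ 6"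
      using key 3 by linarith
    also have "\<dots> \<le> 2 * gauss_pos5 c 1"
      using power6_le_abs_poly[OF 3(2,3) sqrt_2_over_pi_ge] gauss_pos5_ge_abs_poly[of c] by argo
    finally show ?thesis .
  next
    case 4
    \<comment> \<open>Only the second term is present, and \<open>32 * c\<close> is enough as a
      bound for it. As \<open>c\<close> exceeds 2/5, \<open>2 * h \<le> 5 * c * h\<close>, so
      \<open>a \<le> c * (1 + 5 * h)\<close>, to which Bernoulli's inequality applies.\<close>
    define h where "h = (a - c) / 2"
    have h: "0 \<le> h" "h \<le> 1" using 4 a b ab by (auto simp: h_def)
    have eq: "c + b = 2 * (1 - h)" "a = c + 2 * h" using ab by (auto simp: h_def field_simps)
    have "(1 - h) ^ 5 * (1 + 5 * h) \<le> (1 - h) ^ 5 * (1 + h) ^ 5"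
      using h Bernoulli_inequality[of h 5] by (intro mult_left_mono) auto
    also have "\<dots> = (1 - h\<^sup>2) ^ 5"
      by (simp add: power_mult_distrib[symmetric] power2_eq_square algebra_simps)
    also have "\<dots> \<le> 1" using h by (intro power_le_one) (auto simp: power_le_one)
    finally have *: "(1 - h) ^ 5 * (1 + 5 * h) \<le> 1" .
    have "a * (1 - h) ^ 5 \<le> c * (1 + 5 * h) * (1 - h) ^ 5"
      using 4 h mult_right_mono[of "2/5" c h] unfolding eq(2) 
      by (intro mult_right_mono) (auto simp: algebra_simps)
    also have "\<dots> \<le> c"
      using * 4 mult_left_mono[of _ 1 c] by (simp add: mult_ac)
    finally have "a * (c + b) ^ 5 \<le> 32 * c"
      unfolding eq(1) power_mult_distrib by simp
    moreover have "pos_part (c - a) = 0" "pos_part (c + b) = c + b"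
      using 4 a b by (auto simp: pos_part_def)
    moreover have "16 * c \<le> c ^ 5 + 10 * c ^ 3 + 15 * c"
    proof -
      have "1 \<le> 10 * c ^ 2"
        using 4 mult_mono[of "2/5" c "2/5" c] by (simp add: power2_eq_square)
      then have "c * 1 \<le> c * (10 * c ^ 2)" using 4 by (intro mult_left_mono) auto
      moreover have "0 \<le> c ^ 5" using 4 by simp
      ultimately show ?thesis by (simp add: eval_nat_numeral)
    qed
    ultimately show ?thesis
      using gauss_pos5_ge_poly[of c] by simp
  next
    case 5
    \<comment> \<open>Both positive parts are active, so the claim becomes polynomial. For negative
      \<open>e\<close> every coefficient in \<open>c\<close> is nonnegative; otherwise
      \<open>moment_gap_nonneg\<close> applies.\<close>
    define e where "e = 1 - a"
    have e: "a = 1 - e" "b = 1 + e" "-1 \<le> e" "e \<le> 1" using a b ab by (auto simp: e_def)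
    define P where "P = 10*c*(1 - e*c)^2 + 20*e^3*c^2 - (10*e^2 - 15*e^4)*c - 4*e + 4*e^5"
    have "0 \<le> P"
    proof (cases "0 \<le> e")
      case True
      then show ?thesis unfolding P_def using moment_gap_nonneg[of c e] 5 e by simp
    next
      case False
      define g where "g = - e"
      have g: "0 \<le> g" "g ^ 2 \<le> 1" using False e by (auto simp: g_def abs_square_le_1)
      have "g ^ 4 = (g ^ 2) ^ 2" by simp
      with g have g4: "g ^ 4 \<le> 1" using power_le_one[of "g ^ 2" 2] by simp
      have "P = 10*g^2*c^3 + 20*g*(1 - g^2)*c^2 + (10 + 15*g^4 - 10*g^2)*c + 4*g*(1 - g^4)"
        unfolding P_def g_def by (simp add: field_simps eval_nat_numeral)
      also have "\<dots> \<ge> 0"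
        using g g4 5 by (intro add_nonneg_nonneg mult_nonneg_nonneg) (auto simp: add_increasing2)
      finally show ?thesis .
    qed
    moreover have "b * (c - a) ^ 5 + a * (c + b) ^ 5 + 2 * P = 2 * (c ^ 5 + 10 * c ^ 3 + 15 * c)"
      unfolding e P_def by (simp add: field_simps eval_nat_numeral)
    moreover have "pos_part (c - a) = c - a" "pos_part (c + b) = c + b"
      using 5 a b by (auto simp: pos_part_def)
    ultimately show ?thesis
      using gauss_pos5_ge_poly[of c] by simp
  qed
qed

text \<open>By homogeneity of degree six: one power of \<open>s\<close> belongs to the weights, five
  to the positive parts.\<close>

lemma two_point:
  assumes a: "0 \<le> a" and b: "0 \<le> b"
  shows "b * pos_part (w - a) ^ 5 + a * pos_part (w + b) ^ 5 \<le> (a + b) * gauss_pos5 w ((a + b) / 2)"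
proof (cases "a + b = 0")
  case True
  then have "a = 0" "b = 0" using a b by auto
  then show ?thesis by simp
next
  case False
  define s where "s = (a + b) / 2"
  have s: "0 < s" using False a b by (simp add: s_def)
  have "a / s + b / s = 2"
  proof -
    have "a + b = 2 * s" by (simp add: s_def)
    then show ?thesis using s by (simp add: add_divide_distrib[symmetric])
  qed
  then have "b / s * pos_part (w / s - a / s) ^ 5 + a / s * pos_part (w / s + b / s) ^ 5 \<le> 2 * gauss_pos5 (w / s) 1"
    using s a b by (intro two_point_std) auto
  then have "s ^ 6 * (b / s * pos_part (w / s - a / s) ^ 5 + a / s * pos_part (w / s + b / s) ^ 5)
      \<le> s ^ 6 * (2 * gauss_pos5 (w / s) 1)"
    using s by (intro mult_left_mono) auto
  moreover have "pos_part (w - a) = s * pos_part (w / s - a / s)" "pos_part (w + b) = s * pos_part (w / s + b / s)"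
    using s by (simp_all add: pos_part_mult[symmetric] algebra_simps)
  moreover have "gauss_pos5 w s = s ^ 5 * gauss_pos5 (w / s) 1"
    using s gauss_pos5_scale[of s "w / s" 1] by simp
  moreover have "a + b = 2 * s" by (simp add: s_def)
  ultimately show ?thesis
    unfolding s_def[symmetric] using s by (simp add: power_mult_distrib algebra_simps eval_nat_numeral)
qed

text \<open>\<open>two_point\<close> at \<open>w + r * z\<close>, integrated against the normal
  density; the convolution identity adds the variances.\<close>

lemma two_point_gauss:
  assumes a: "0 \<le> a" and b: "0 \<le> b" and r: "0 \<le> r"
  shows "b * gauss_pos5 (w - a) r + a * gauss_pos5 (w + b) r
    \<le> (a + b) * gauss_pos5 w (sqrt (r\<^sup>2 + ((a + b) / 2)\<^sup>2))"
proof (cases "a + b = 0")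
  case True
  then have "a = 0" "b = 0" using a b by auto
  then show ?thesis by simp
next
  case False
  then have s: "0 < (a + b) / 2" using a b by simp
  note I = has_bochner_integral_gauss_pos5[OF r s, of w]
  have "b * gauss_pos5 (w - a) r + a * gauss_pos5 (w + b) r =
    (\<integral>z. b * (std_normal_density z * pos_part (w - a + r * z) ^ 5)
      + a * (std_normal_density z * pos_part (w + b + r * z) ^ 5) \<partial>lborel)"
    using integrable_gauss_pos5[of "w - a" r] integrable_gauss_pos5[of "w + b" r]
    by (subst Bochner_Integration.integral_add) (simp_all add: gauss_pos5_def)
  also have "\<dots> \<le> (\<integral>z. (a + b) * (std_normal_density z * gauss_pos5 (w + r * z) ((a + b) / 2)) \<partial>lborel)"
  proof (intro integral_mono Bochner_Integration.integrable_add integrable_mult_right integrable_gauss_pos5)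
    show "integrable lborel (\<lambda>z. std_normal_density z * gauss_pos5 (w + r * z) ((a + b) / 2))"
      using I by (simp add: has_bochner_integral_iff)
    fix z
    show "b * (std_normal_density z * pos_part (w - a + r * z) ^ 5)
      + a * (std_normal_density z * pos_part (w + b + r * z) ^ 5)
      \<le> (a + b) * (std_normal_density z * gauss_pos5 (w + r * z) ((a + b) / 2))"
      using mult_left_mono[OF two_point[OF a b, of "w + r * z"], of "std_normal_density z"]
      by (simp add: algebra_simps)
  qed
  also have "\<dots> = (a + b) * gauss_pos5 w (sqrt (r\<^sup>2 + ((a + b) / 2)\<^sup>2))"
    using I by (simp add: has_bochner_integral_iff)
  finally show ?thesis .
qed

text \<open>Convexity bounds the value at \<open>w\<close> by the mean over \<open>w - s\<close> and
  \<open>w + s\<close>, and the symmetric two-point inequality raises the variance by exactly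
  s^2.\<close>

lemma gauss_pos5_mono_right:
  assumes "0 \<le> r" "r \<le> r'"
  shows "gauss_pos5 w r \<le> gauss_pos5 w r'"
proof (cases "r = r'")
  case False
  define s where "s = sqrt (r'\<^sup>2 - r\<^sup>2)"
  have s: "0 < s" "s\<^sup>2 = r'\<^sup>2 - r\<^sup>2"
    using assms False by (auto simp: s_def power_mono power_strict_mono)
  have "gauss_pos5 w r \<le> (gauss_pos5 (w - s) r + gauss_pos5 (w + s) r) / 2"
    using convex_onD[OF convex_on_gauss_pos5[of r], of "1/2" "w - s" "w + s"] by (simp add: field_simps)
  also have "\<dots> \<le> gauss_pos5 w (sqrt (r\<^sup>2 + s\<^sup>2))"
  proof -
    have "s * (gauss_pos5 (w - s) r + gauss_pos5 (w + s) r) \<le> s * (2 * gauss_pos5 w (sqrt (r\<^sup>2 + s\<^sup>2)))"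
      using two_point_gauss[of s s r w] s assms by (simp add: algebra_simps)
    then show ?thesis using s by simp
  qed
  also have "sqrt (r\<^sup>2 + s\<^sup>2) = r'"
    using s assms by simp
  finally show ?thesis .
qed simp

text \<open>Jensen's inequality, as the comparison with deviation 0.\<close>

lemma pos_part_power5_le_gauss_pos5: "0 \<le> r \<Longrightarrow> pos_part w ^ 5 \<le> gauss_pos5 w r"
  using gauss_pos5_mono_right[of 0 r w] by (simp add: gauss_pos5_0)

text \<open>The value \<open>0\<close> is what the case \<open>b < 0\<close> of \<open>gauss_pos5_chord\<close> needs, by monotonicity.\<close>

definition chord_slope :: "real \<Rightarrow> real \<Rightarrow> real \<Rightarrow> real \<Rightarrow> real" where
  "chord_slope w r a b =
    (if 0 \<le> b \<and> a < b then (gauss_pos5 (w + b) r - gauss_pos5 (w + a) r) / (b - a) else 0)"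

lemma chord_slope_nonneg: "0 \<le> chord_slope w r a b"
  by (auto simp: chord_slope_def intro!: divide_nonneg_nonneg gauss_pos5_mono_left)

text \<open>By convexity the slope is at most that over the next unit interval. The bound stays
  finite however close \<open>a\<close> and \<open>b\<close> are, which later makes slope times
  increment integrable.\<close>

lemma chord_slope_le: "chord_slope w r a b \<le> gauss_pos5 (w + b + 1) r"
proof (cases "0 \<le> b \<and> a < b")
  case True
  note slopes = convex_on_slope_le[OF convex_on_gauss_pos5, of "w + a" "w + b + 1" "w + b" r]
  have "(gauss_pos5 (w + a) r - gauss_pos5 (w + b) r) / ((w + a) - (w + b))
      \<le> (gauss_pos5 (w + b) r - gauss_pos5 (w + b + 1) r) / ((w + b) - (w + b + 1))"
    by (rule order_trans[OF slopes]) (use True in auto)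
  also have "(gauss_pos5 (w + a) r - gauss_pos5 (w + b) r) / ((w + a) - (w + b)) = chord_slope w r a b"
    using True minus_divide_divide[of "gauss_pos5 (w + b) r - gauss_pos5 (w + a) r" "b - a"]
    by (simp add: chord_slope_def)
  finally show ?thesis
    using gauss_pos5_nonneg[of "w + b" r] by simp
qed (auto simp: chord_slope_def gauss_pos5_nonneg)

text \<open>By convexity the graph lies below its chord, whose value at 0 is a two-point mean
  bounded by \<open>two_point_gauss\<close>. The term linear in \<open>x\<close> has a nonnegative
  slope, so the drift condition controls its expectation.\<close>

lemma gauss_pos5_chord:
  assumes "a \<le> 0" "a \<le> x" "x \<le> b" "0 \<le> r"
  shows "gauss_pos5 (w + x) r
    \<le> gauss_pos5 w (sqrt (r\<^sup>2 + ((b - a) / 2)\<^sup>2)) + chord_slope w r a b * x"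
proof (cases "0 \<le> b \<and> a < b")
  case True
  let ?g = "\<lambda>x. gauss_pos5 (w + x) r"
  have "?g x \<le> (?g b - ?g a) / (b - a) * (x - a) + ?g a"
    using convex_onD_Icc'[of "w + a" "w + b" "\<lambda>w. gauss_pos5 w r" "w + x"]
      convex_on_subset[OF convex_on_gauss_pos5, of "{w + a..w + b}" r] assms by simp
  also have "\<dots> = (b * ?g a + (- a) * ?g b) / (b - a) + chord_slope w r a b * x"
  proof -
    \<comment> \<open>The chord has the value \<open>?g a - a * m\<close> at 0, the mean of
      \<open>?g a\<close> and \<open>?g b\<close> with weights proportional to \<open>b\<close> and
      \<open>- a\<close>.\<close>
    define m where "m = (?g b - ?g a) / (b - a)"
    have "m * (b - a) = ?g b - ?g a" using True by (simp add: m_def)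
    then have "b * ?g a + (- a) * ?g b = (?g a - a * m) * (b - a)"
      by algebra
    then have e1: "(b * ?g a + (- a) * ?g b) / (b - a) = ?g a - a * m"
      using True by simp
    have e2: "chord_slope w r a b = m" using True by (simp add: chord_slope_def m_def)
    show ?thesis unfolding m_def[symmetric] e1 e2 by (simp add: algebra_simps)
  qed
  also have "(b * ?g a + (- a) * ?g b) / (b - a) \<le> gauss_pos5 w (sqrt (r\<^sup>2 + ((b - a) / 2)\<^sup>2))"
    using two_point_gauss[of "- a" b r w] assms True by (simp add: field_simps)
  finally show ?thesis by simp
next
  case False
  then have "x \<le> 0" using assms by auto
  then have "gauss_pos5 (w + x) r \<le> gauss_pos5 w r"
    by (intro gauss_pos5_mono_left) simp
  also have "\<dots> \<le> gauss_pos5 w (sqrt (r\<^sup>2 + ((b - a) / 2)\<^sup>2))"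
    using assms by (intro gauss_pos5_mono_right real_le_rsqrt) auto
  also have "\<dots> = \<dots> + chord_slope w r a b * x"
    unfolding chord_slope_def if_not_P[OF False] by simp
  finally show ?thesis .
qed

subsection \<open>The supermartingale\<close>

text \<open>Integrating the conditional probability gives the event probability 1.\<close>

lemma (in prob_space) AE_of_cond_prob_on_eq_1:
  assumes sub: "subalgebra M G" and E: "E \<in> sets M"
    and 1: "AE \<omega> in M. cond_prob_on M G E \<omega> = 1"
  shows "AE \<omega> in M. \<omega> \<in> E"
proof -
  interpret finite_measure_subalgebra M G
    using sub by unfold_locales
  have "prob E = (\<integral>\<omega>. indicat_real E \<omega> \<partial>M)"
    using E by simp
  also have "\<dots> = (\<integral>\<omega>. cond_prob_on M G E \<omega> \<partial>M)"
    unfolding cond_prob_on_def using E by (intro real_cond_exp_int(2)[symmetric]) (simp add: emeasure_eq_measure)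
  also have "\<dots> = (\<integral>\<omega>. 1 \<partial>M)"
    using 1 by (intro integral_cong_AE) (auto simp: cond_prob_on_def)
  also have "\<dots> = 1"
    by (simp add: prob_space)
  finally show ?thesis
    using E by (intro AE_prob_1)
qed

text \<open>The measurable factor \<open>g\<close> is pulled out of the conditional
  expectation.\<close>

lemma (in prob_space) integral_mult_nonpos_of_cond_exp_nonpos:
  assumes sub: "subalgebra M G" and X: "integrable M X"
    and drift: "AE \<omega> in M. real_cond_exp M G X \<omega> \<le> 0"
    and g: "g \<in> borel_measurable G" "\<And>\<omega>. 0 \<le> g \<omega>" and int: "integrable M (\<lambda>\<omega>. g \<omega> * X \<omega>)"
  shows "(\<integral>\<omega>. g \<omega> * X \<omega> \<partial>M) \<le> 0"
proof -
  interpret finite_measure_subalgebra M G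
    using sub by unfold_locales
  have "(\<integral>\<omega>. g \<omega> * X \<omega> \<partial>M) = (\<integral>\<omega>. g \<omega> * real_cond_exp M G X \<omega> \<partial>M)"
    using real_cond_exp_intg(2)[OF int g(1)] X by simp
  also have "\<dots> \<le> 0"
  proof -
    have "0 \<le> (\<integral>\<omega>. - (g \<omega> * real_cond_exp M G X \<omega>) \<partial>M)"
      by (intro integral_nonneg_AE) (use drift g(2) in \<open>auto simp: mult_nonneg_nonpos\<close>)
    then show ?thesis by simp
  qed
  finally show ?thesis .
qed

text \<open>On the event that \<open>A\<close> is positive so is \<open>X\<close>, while the
  integral of \<open>X\<close> over it is at most 0; hence the event is null. This supplies the
  condition \<open>a \<le> 0\<close> of \<open>gauss_pos5_chord\<close>.\<close>

lemma (in prob_space) AE_lower_bound_nonpos: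
  assumes sub: "subalgebra M G" and X: "integrable M X"
    and drift: "AE \<omega> in M. real_cond_exp M G X \<omega> \<le> 0"
    and A[measurable]: "A \<in> borel_measurable G" and le: "AE \<omega> in M. A \<omega> \<le> X \<omega>"
  shows "AE \<omega> in M. A \<omega> \<le> 0"
proof -
  define C where "C = {\<omega> \<in> space G. 0 < A \<omega>}"
  have C: "C \<in> sets G" unfolding C_def by measurable
  have CM: "C \<in> sets M" using C sub by (auto simp: subalgebra_def)
  have sp: "space G = space M" using sub by (simp add: subalgebra_def)
  have int: "integrable M (\<lambda>\<omega>. indicator C \<omega> * X \<omega>)"
    using integrable_mult_indicator[OF CM X] by simp
  have nn: "AE \<omega> in M. 0 \<le> indicator C \<omega> * X \<omega>"
    using le by eventually_elim (auto simp: C_def indicator_def)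
  have "(\<integral>\<omega>. indicator C \<omega> * X \<omega> \<partial>M) \<le> 0"
    using C by (intro integral_mult_nonpos_of_cond_exp_nonpos[OF sub X drift _ _ int]) auto
  then have "(\<integral>\<omega>. indicator C \<omega> * X \<omega> \<partial>M) = 0"
    using integral_nonneg_AE[OF nn] by simp
  then have "AE \<omega> in M. indicator C \<omega> * X \<omega> = 0"
    using integral_nonneg_eq_0_iff_AE[OF int nn] by simp
  with le AE_space show ?thesis
    by eventually_elim (auto simp: C_def sp indicator_def split: if_splits)
qed

section \<open>The one-step inequality and the maximal inequality\<close>

lemma borel_measurable_chord_slope [measurable (raw)]:
  assumes [measurable]: "w \<in> borel_measurable M" "r \<in> borel_measurable M" "a \<in> borel_measurable M" "b \<in> borel_measurable M"
  shows "(\<lambda>x. chord_slope (w x) (r x) (a x) (b x)) \<in> borel_measurable M"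
  unfolding chord_slope_def by measurable

text \<open>The chord bound in expectation. \<open>U\<close> is the event of not being killed, known
  before the step, and \<open>r\<close> the deviation left after it; the constants \<open>K\<close>
  and \<open>R\<close> provide integrability.\<close>

lemma (in prob_space) gauss_pos5_step:
  assumes sub: "subalgebra M G" and X: "integrable M X"
    and drift: "AE \<omega> in M. real_cond_exp M G X \<omega> \<le> 0"
    and A[measurable]: "A \<in> borel_measurable G" and B[measurable]: "B \<in> borel_measurable G"
    and AXB: "AE \<omega> in M. A \<omega> \<le> X \<omega> \<and> X \<omega> \<le> B \<omega>"
    and W[measurable]: "W \<in> borel_measurable G" and r[measurable]: "r \<in> borel_measurable G" and U[measurable]: "U \<in> sets G"
    and bound: "AE \<omega> in M. \<omega> \<in> U \<longrightarrow> W \<omega> \<le> K \<and> W \<omega> + B \<omega> \<le> K \<and> 0 \<le> r \<omega> \<and>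
      sqrt ((r \<omega>)\<^sup>2 + ((B \<omega> - A \<omega>) / 2)\<^sup>2) \<le> R"
  shows "integrable M (\<lambda>\<omega>. indicator U \<omega> * gauss_pos5 (W \<omega> + X \<omega>) (r \<omega>))"
    and "integrable M (\<lambda>\<omega>. indicator U \<omega> * gauss_pos5 (W \<omega>) (sqrt ((r \<omega>)\<^sup>2 + ((B \<omega> - A \<omega>) / 2)\<^sup>2)))"
    and "(\<integral>\<omega>. indicator U \<omega> * gauss_pos5 (W \<omega> + X \<omega>) (r \<omega>) \<partial>M)
      \<le> (\<integral>\<omega>. indicator U \<omega> * gauss_pos5 (W \<omega>) (sqrt ((r \<omega>)\<^sup>2 + ((B \<omega> - A \<omega>) / 2)\<^sup>2)) \<partial>M)"
proof -
  let ?r' = "\<lambda>\<omega>. sqrt ((r \<omega>)\<^sup>2 + ((B \<omega> - A \<omega>) / 2)\<^sup>2)"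
  have UM[measurable]: "U \<in> sets M" using U sub by (auto simp: subalgebra_def)
  have [measurable]: "X \<in> borel_measurable M" using X by simp
  note from_sub = measurable_from_subalg[OF sub]
  have [measurable]: "A \<in> borel_measurable M" "B \<in> borel_measurable M" "W \<in> borel_measurable M" "r \<in> borel_measurable M"
    by (rule from_sub; measurable)+
  define g where "g = (\<lambda>\<omega>. indicator U \<omega> * chord_slope (W \<omega>) (r \<omega>) (A \<omega>) (B \<omega>))"
  have A0: "AE \<omega> in M. A \<omega> \<le> 0"
    using AXB by (intro AE_lower_bound_nonpos[OF sub X drift A]) auto
  have g_meas: "g \<in> borel_measurable G" unfolding g_def by measurable
  then have [measurable]: "g \<in> borel_measurable M" by (rule from_sub)
  have r_le: "r \<omega> \<le> ?r' \<omega>" if "0 \<le> r \<omega>" for \<omega>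
    using that by (intro real_le_rsqrt) auto
  have g_nonneg: "0 \<le> g \<omega>" for \<omega>
    by (simp add: g_def chord_slope_nonneg)
  \<comment> \<open>On \<open>U\<close> the slope is at most a constant, so the product is dominated
    by a multiple of \<open>X\<close>.\<close>
  have gX_bound: "AE \<omega> in M. norm (g \<omega> * X \<omega>) \<le> norm (gauss_pos5 (K + 1) R * X \<omega>)"
    using bound
  proof eventually_elim
    case (elim \<omega>)
    show ?case
    proof (cases "\<omega> \<in> U")
      case True
      have "g \<omega> \<le> gauss_pos5 (W \<omega> + B \<omega> + 1) (r \<omega>)"
        using True chord_slope_le by (simp add: g_def)
      also have "\<dots> \<le> gauss_pos5 (K + 1) (r \<omega>)"
        using elim True by (intro gauss_pos5_mono_left) simp
      also have "\<dots> \<le> gauss_pos5 (K + 1) R"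
        using elim True order_trans[OF r_le] by (intro gauss_pos5_mono_right) blast+
      finally show ?thesis
        using g_nonneg[of \<omega>] gauss_pos5_nonneg[of "K + 1" R]
        by (simp add: abs_mult mult_right_mono)
    qed (simp add: g_def)
  qed
  have int_gX: "integrable M (\<lambda>\<omega>. g \<omega> * X \<omega>)"
    by (rule Bochner_Integration.integrable_bound[OF integrable_mult_right[OF X] _ gX_bound]) measurable
  have gX: "(\<integral>\<omega>. g \<omega> * X \<omega> \<partial>M) \<le> 0"
    by (rule integral_mult_nonpos_of_cond_exp_nonpos[OF sub X drift g_meas g_nonneg int_gX])
  have "AE \<omega> in M. norm (indicator U \<omega> * gauss_pos5 (W \<omega> + X \<omega>) (r \<omega>)) \<le> gauss_pos5 K R"
    using bound AXB
  proof eventually_elim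
    case (elim \<omega>)
    have "gauss_pos5 (W \<omega> + X \<omega>) (r \<omega>) \<le> gauss_pos5 K R" if "\<omega> \<in> U"
    proof (rule order_trans[OF gauss_pos5_mono_left gauss_pos5_mono_right])
      show "W \<omega> + X \<omega> \<le> K" "0 \<le> r \<omega>" using elim that by auto
      then show "r \<omega> \<le> R" using elim that order_trans[OF r_le] by blast
    qed
    then show ?case by (auto simp: indicator_def gauss_pos5_nonneg)
  qed
  then show i1: "integrable M (\<lambda>\<omega>. indicator U \<omega> * gauss_pos5 (W \<omega> + X \<omega>) (r \<omega>))"
    by (intro integrable_const_bound) auto
  have "AE \<omega> in M. norm (indicator U \<omega> * gauss_pos5 (W \<omega>) (?r' \<omega>)) \<le> gauss_pos5 K R"
    using bound
  proof eventually_elim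
    case (elim \<omega>)
    have "gauss_pos5 (W \<omega>) (?r' \<omega>) \<le> gauss_pos5 K R" if "\<omega> \<in> U"
      by (rule order_trans[OF gauss_pos5_mono_left gauss_pos5_mono_right])
        (use elim that in auto)
    then show ?case by (auto simp: indicator_def gauss_pos5_nonneg)
  qed
  then show i2: "integrable M (\<lambda>\<omega>. indicator U \<omega> * gauss_pos5 (W \<omega>) (?r' \<omega>))"
    by (intro integrable_const_bound) auto
  have "AE \<omega> in M. indicator U \<omega> * gauss_pos5 (W \<omega> + X \<omega>) (r \<omega>)
      \<le> indicator U \<omega> * gauss_pos5 (W \<omega>) (?r' \<omega>) + g \<omega> * X \<omega>"
    using bound AXB A0
  proof eventually_elim
    case (elim \<omega>)
    then show ?case
      using gauss_pos5_chord[of "A \<omega>" "X \<omega>" "B \<omega>" "r \<omega>" "W \<omega>"] by (auto simp: g_def indicator_def)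
  qed
  then have "(\<integral>\<omega>. indicator U \<omega> * gauss_pos5 (W \<omega> + X \<omega>) (r \<omega>) \<partial>M)
      \<le> (\<integral>\<omega>. indicator U \<omega> * gauss_pos5 (W \<omega>) (?r' \<omega>) + g \<omega> * X \<omega> \<partial>M)"
    using i1 i2 int_gX by (intro integral_mono_AE) auto
  also have "\<dots> \<le> (\<integral>\<omega>. indicator U \<omega> * gauss_pos5 (W \<omega>) (?r' \<omega>) \<partial>M)"
    using i2 int_gX gX by simp
  finally show "(\<integral>\<omega>. indicator U \<omega> * gauss_pos5 (W \<omega> + X \<omega>) (r \<omega>) \<partial>M)
      \<le> (\<integral>\<omega>. indicator U \<omega> * gauss_pos5 (W \<omega>) (?r' \<omega>) \<partial>M)" .
qed

text \<open>Instead of a stopping time, induction on \<open>n\<close> shows that the probability of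
  a hit by time \<open>n\<close>, plus the expectation of the process over paths neither hit nor
  killed, never exceeds the initial value.\<close>

lemma (in prob_space) gauss_pos5_maximal:
  assumes sub: "\<And>i. subalgebra M (F i)" and mono: "\<And>i j. i \<le> j \<Longrightarrow> sets (F i) \<subseteq> sets (F j)"
    and X_int: "\<And>i. integrable M (X i)" and X_meas: "\<And>i. X i \<in> borel_measurable (F i)"
    and drift: "\<And>i. AE \<omega> in M. real_cond_exp M (F i) (X (Suc i)) \<omega> \<le> 0"
    and A: "\<And>i. A (Suc i) \<in> borel_measurable (F i)" and B: "\<And>i. B (Suc i) \<in> borel_measurable (F i)"
    and AXB: "\<And>i. AE \<omega> in M. A (Suc i) \<omega> \<le> X (Suc i) \<omega> \<and> X (Suc i) \<omega> \<le> B (Suc i) \<omega>"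
    and v: "0 \<le> v"
  shows "prob {\<omega> \<in> space M. \<exists>n\<ge>1. 1 \<le> p + (\<Sum>i=1..n. X i \<omega>) \<and> (\<Sum>i=1..n. (B i \<omega> - A i \<omega>)\<^sup>2) \<le> 4 * v\<^sup>2}
    \<le> gauss_pos5 p v"
proof -
  have sp: "space (F i) = space M" for i using sub[of i] by (simp add: subalgebra_def)
  have F_mono: "f \<in> borel_measurable (F i) \<Longrightarrow> i \<le> j \<Longrightarrow> f \<in> borel_measurable (F j)" for f :: "'a \<Rightarrow> real" and i j
    using mono[of i j] sp by (auto simp: measurable_def)
  have sets_F: "E \<in> sets (F i) \<Longrightarrow> E \<in> sets M" for E i
    using sub[of i] by (auto simp: subalgebra_def)
  define S where "S n \<omega> = (\<Sum>i=1..n. X i \<omega>)" for n \<omega>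
  define Q where "Q n \<omega> = (\<Sum>i=1..n. (B i \<omega> - A i \<omega>)\<^sup>2)" for n \<omega>
  define R where "R n \<omega> = sqrt (v\<^sup>2 - Q n \<omega> / 4)" for n \<omega>
  define H where "H n = {\<omega> \<in> space M. 1 \<le> p + S n \<omega> \<and> Q n \<omega> \<le> 4 * v\<^sup>2}" for n
  \<comment> \<open>The paths hit by time \<open>n\<close>. Times start at 1, so \<open>T 0\<close>
    is empty.\<close>
  define T where "T n = (\<Union>k\<in>{1..n}. H k)" for n
  have T_Suc: "T (Suc n) = T n \<union> H (Suc n)" for n
    unfolding T_def by (auto simp: atLeastAtMostSuc_conv)
  define N where "N n = {\<omega> \<in> space M. Q n \<omega> \<le> 4 * v\<^sup>2} - T n" for n
  have S_meas: "S n \<in> borel_measurable (F n)" for n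
    unfolding S_def by (intro borel_measurable_sum F_mono[OF X_meas]) auto
  have Q_Suc: "Q (Suc n) \<omega> = Q n \<omega> + (B (Suc n) \<omega> - A (Suc n) \<omega>)\<^sup>2" for n \<omega>
    by (simp add: Q_def)
  have S_Suc: "S (Suc n) \<omega> = S n \<omega> + X (Suc n) \<omega>" for n \<omega>
    by (simp add: S_def)
  have Q_pred: "Q (Suc n) \<in> borel_measurable (F n)" for n
    unfolding Q_def
  proof (intro borel_measurable_sum borel_measurable_power borel_measurable_diff)
    fix i assume "i \<in> {1..Suc n}"
    then obtain j where "i = Suc j" "j \<le> n" by (cases i) auto
    then show "A i \<in> borel_measurable (F n)" "B i \<in> borel_measurable (F n)"
      using F_mono A B by blast+
  qed
  have Q_meas: "Q n \<in> borel_measurable (F n)" for n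
  proof (cases n)
    case (Suc m)
    then show ?thesis using F_mono[OF Q_pred[of m]] by simp
  qed (simp add: Q_def[abs_def])
  have Q_mono: "Q m \<omega> \<le> Q n \<omega>" if "m \<le> n" for m n \<omega>
    unfolding Q_def using that by (intro sum_mono2) auto
  have H_sets: "H n \<in> sets (F n)" for n
  proof -
    note [measurable] = S_meas[of n] Q_meas[of n]
    show ?thesis unfolding H_def sp[of n, symmetric] by measurable
  qed
  have T_sets: "T n \<in> sets (F n)" for n
    unfolding T_def using H_sets mono by (intro sets.finite_UN) auto
  \<comment> \<open>The paths not hit by time \<open>n\<close> that survive the killing at the next
    step. As the bounds are predictable, this is already known at time \<open>n\<close>.\<close>
  define U where "U n = {\<omega> \<in> space M. Q (Suc n) \<omega> \<le> 4 * v\<^sup>2} - T n" for n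
  have U_sets: "U n \<in> sets (F n)" for n
  proof -
    note [measurable] = Q_pred[of n]
    have "{\<omega> \<in> space (F n). Q (Suc n) \<omega> \<le> 4 * v\<^sup>2} \<in> sets (F n)" by measurable
    then show ?thesis unfolding U_def using T_sets[of n] by (simp add: sp)
  qed
  have N_sets: "N n \<in> sets M" for n
  proof -
    note [measurable] = Q_meas[of n]
    have "{\<omega> \<in> space (F n). Q n \<omega> \<le> 4 * v\<^sup>2} \<in> sets (F n)" by measurable
    then show ?thesis unfolding N_def using T_sets[of n] by (intro sets_F[of _ n]) (simp add: sp)
  qed
  have A_le: "AE \<omega> in M. A (Suc i) \<omega> \<le> 0" for i
    using AXB by (intro AE_lower_bound_nonpos[OF sub X_int drift A]) auto
  have good: "AE \<omega> in M. \<forall>i. A (Suc i) \<omega> \<le> 0 \<and> A (Suc i) \<omega> \<le> X (Suc i) \<omega> \<and> X (Suc i) \<omega> \<le> B (Suc i) \<omega>"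
    unfolding AE_all_countable using A_le AXB by (intro allI AE_conjI) auto
  \<comment> \<open>On \<open>U n\<close> every width is at most \<open>2 * v\<close> and the lower
    bounds are nonpositive, so each upper bound, and hence each increment, is at most
    \<open>2 * v\<close>.\<close>
  have bounds: "AE \<omega> in M. \<omega> \<in> U n \<longrightarrow> p + S n \<omega> \<le> p + 2 * v * real (Suc n) \<and>
      p + S n \<omega> + B (Suc n) \<omega> \<le> p + 2 * v * real (Suc n) \<and> 0 \<le> R (Suc n) \<omega> \<and>
      sqrt ((R (Suc n) \<omega>)\<^sup>2 + ((B (Suc n) \<omega> - A (Suc n) \<omega>) / 2)\<^sup>2) \<le> v" for n
    using good
  proof eventually_elim
    case (elim \<omega>)
    show ?case
    proof (intro impI)
      assume "\<omega> \<in> U n"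
      then have Qv: "Q (Suc n) \<omega> \<le> 4 * v\<^sup>2" by (simp add: U_def)
      have B_le: "B (Suc i) \<omega> \<le> 2 * v" if "i \<le> n" for i
      proof -
        have "(B (Suc i) \<omega> - A (Suc i) \<omega>)\<^sup>2 \<le> Q (Suc i) \<omega>"
          unfolding Q_Suc by (simp add: Q_def sum_nonneg)
        also have "\<dots> \<le> (2 * v)\<^sup>2"
          using Q_mono[of "Suc i" "Suc n" \<omega>] that Qv by (simp add: power_mult_distrib)
        finally have "B (Suc i) \<omega> - A (Suc i) \<omega> \<le> 2 * v"
          by (rule power2_le_imp_le) (use v in simp)
        then show ?thesis using elim[rule_format, of i] by linarith
      qed
      have "S k \<omega> \<le> 2 * v * real k" if "k \<le> Suc n" for k
        using that
      proof (induction k)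
        case (Suc k)
        then show ?case
          using B_le[of k] elim[rule_format, of k] unfolding S_Suc by (simp add: algebra_simps)
      qed (simp add: S_def)
      then have Sn: "S n \<omega> \<le> 2 * v * real n" by simp
      moreover have "(R (Suc n) \<omega>)\<^sup>2 = v\<^sup>2 - Q (Suc n) \<omega> / 4"
        unfolding R_def using Qv by (intro real_sqrt_pow2) simp
      then have "(R (Suc n) \<omega>)\<^sup>2 + ((B (Suc n) \<omega> - A (Suc n) \<omega>) / 2)\<^sup>2 \<le> v\<^sup>2"
        using sum_nonneg[of "{1..n}" "\<lambda>i. (B i \<omega> - A i \<omega>)\<^sup>2"]
        by (simp add: Q_Suc power_divide Q_def)
      then have "sqrt ((R (Suc n) \<omega>)\<^sup>2 + ((B (Suc n) \<omega> - A (Suc n) \<omega>) / 2)\<^sup>2) \<le> v"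
        using v by (intro real_le_lsqrt) auto
      moreover have "0 \<le> R (Suc n) \<omega>" using Qv by (simp add: R_def)
      ultimately show "p + S n \<omega> \<le> p + 2 * v * real (Suc n) \<and>
        p + S n \<omega> + B (Suc n) \<omega> \<le> p + 2 * v * real (Suc n) \<and> 0 \<le> R (Suc n) \<omega> \<and>
        sqrt ((R (Suc n) \<omega>)\<^sup>2 + ((B (Suc n) \<omega> - A (Suc n) \<omega>) / 2)\<^sup>2) \<le> v"
        using B_le[of n] v by (simp add: algebra_simps)
    qed
  qed
  have W_meas: "(\<lambda>\<omega>. p + S n \<omega>) \<in> borel_measurable (F n)" for n
    using S_meas[of n] by simp
  have R_meas: "R (Suc n) \<in> borel_measurable (F n)" for n
    unfolding R_def[abs_def] using Q_pred[of n] by measurable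
  note step = gauss_pos5_step[OF sub X_int drift A B AXB W_meas R_meas U_sets bounds]
  have RR: "sqrt ((R (Suc n) \<omega>)\<^sup>2 + ((B (Suc n) \<omega> - A (Suc n) \<omega>) / 2)\<^sup>2) = R n \<omega>" if "\<omega> \<in> U n" for n \<omega>
  proof -
    have "(R (Suc n) \<omega>)\<^sup>2 = v\<^sup>2 - Q (Suc n) \<omega> / 4"
      unfolding R_def using that by (intro real_sqrt_pow2) (simp add: U_def)
    then show ?thesis unfolding R_def by (simp add: Q_Suc power_divide field_simps)
  qed
  have UN: "U n \<subseteq> N n" for n
    using Q_mono[of n "Suc n"] unfolding U_def N_def by (auto intro: order_trans)
  \<comment> \<open>The paths of \<open>U n\<close> are either newly hit at time
    \<open>Suc n\<close> or still running.\<close>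
  have U_eq: "indicator (U n) \<omega> = (indicator (H (Suc n) - T n) \<omega> + indicator (N (Suc n)) \<omega> :: real)" for n \<omega>
  proof -
    have "U n = (H (Suc n) - T n) \<union> N (Suc n)" "(H (Suc n) - T n) \<inter> N (Suc n) = {}"
      unfolding U_def N_def T_Suc H_def by auto
    then show ?thesis by (auto simp: indicator_def)
  qed
  define a where "a n = (\<integral>\<omega>. indicator (N n) \<omega> * gauss_pos5 (p + S n \<omega>) (R n \<omega>) \<partial>M)" for n
  have HT: "H (Suc n) - T n \<in> sets M" for n
    using sets_F[OF H_sets[of "Suc n"]] sets_F[OF T_sets[of n]] by auto
  have meas: "(\<lambda>\<omega>. gauss_pos5 (p + S n \<omega>) (R n \<omega>)) \<in> borel_measurable M" for n
  proof -
    have [measurable]: "S n \<in> borel_measurable M" "Q n \<in> borel_measurable M"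
      using measurable_from_subalg[OF sub] S_meas Q_meas by blast+
    show ?thesis unfolding R_def by measurable
  qed
  have inv: "integrable M (\<lambda>\<omega>. indicator (N n) \<omega> * gauss_pos5 (p + S n \<omega>) (R n \<omega>)) \<and>
      prob (T n) + a n \<le> gauss_pos5 p v" for n
  proof (induction n)
    case 0
    have "S 0 \<omega> = 0" "R 0 \<omega> = v" "N 0 = space M" for \<omega>
      using v by (auto simp: S_def R_def Q_def T_def N_def)
    moreover have "(\<integral>\<omega>. indicator (space M) \<omega> * gauss_pos5 p v \<partial>M) = gauss_pos5 p v"
      by (simp add: prob_space)
    ultimately show ?case by (simp add: a_def T_def prob_space emeasure_eq_measure)
  next
    case (Suc n)
    let ?g = "\<lambda>\<omega>. gauss_pos5 (p + S (Suc n) \<omega>) (R (Suc n) \<omega>)"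
    have iU: "integrable M (\<lambda>\<omega>. indicator (U n) \<omega> * ?g \<omega>)"
      using step(1)[of n] by (simp add: S_Suc add.assoc)
    have part: "integrable M (\<lambda>\<omega>. indicator E \<omega> * ?g \<omega>)" if "E \<in> sets M" "E \<subseteq> U n" for E
      using that meas[of "Suc n"]
      by (intro Bochner_Integration.integrable_bound[OF iU] AE_I2)
        (auto simp: indicator_def)
    have sub_U: "H (Suc n) - T n \<subseteq> U n" "N (Suc n) \<subseteq> U n"
    proof -
      have "\<omega> \<in> U n" if "indicator (H (Suc n) - T n) \<omega> + indicator (N (Suc n)) \<omega> > (0::real)" for \<omega>
        using that unfolding U_eq[symmetric] by (auto simp: indicator_def split: if_splits)
      then show "H (Suc n) - T n \<subseteq> U n" "N (Suc n) \<subseteq> U n"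
        by (auto simp: indicator_def)
    qed
    note iN = part[OF N_sets sub_U(2)] and iH = part[OF HT sub_U(1)]
    have "prob (T (Suc n)) = prob (T n \<union> (H (Suc n) - T n))"
      by (simp add: T_Suc)
    also have "\<dots> \<le> prob (T n) + prob (H (Suc n) - T n)"
      using sets_F[OF T_sets[of n]] HT by (intro measure_Un_le)
    also have "prob (H (Suc n) - T n) = (\<integral>\<omega>. indicator (H (Suc n) - T n) \<omega> \<partial>M)"
      using HT by simp
    also have "\<dots> \<le> (\<integral>\<omega>. indicator (H (Suc n) - T n) \<omega> * ?g \<omega> \<partial>M)"
    proof (intro integral_mono iH)
      show "integrable M (indicat_real (H (Suc n) - T n))" using HT by (simp add: emeasure_eq_measure)
      fix \<omega>
      have "1 \<le> ?g \<omega>" if "\<omega> \<in> H (Suc n)"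
      proof -
        have "1 \<le> p + S (Suc n) \<omega>" "0 \<le> R (Suc n) \<omega>"
          using that by (auto simp: H_def R_def)
        then have "1 \<le> pos_part (p + S (Suc n) \<omega>) ^ 5"
          by (intro one_le_power) (simp add: pos_part_def)
        also have "\<dots> \<le> ?g \<omega>" by (rule pos_part_power5_le_gauss_pos5) fact
        finally show ?thesis .
      qed
      then show "indicat_real (H (Suc n) - T n) \<omega> \<le> indicat_real (H (Suc n) - T n) \<omega> * ?g \<omega>"
        by (auto simp: indicator_def)
    qed
    finally have "prob (T (Suc n)) + a (Suc n)
        \<le> prob (T n) + ((\<integral>\<omega>. indicator (H (Suc n) - T n) \<omega> * ?g \<omega> \<partial>M) + a (Suc n))"
      by simp
    also have "(\<integral>\<omega>. indicator (H (Suc n) - T n) \<omega> * ?g \<omega> \<partial>M) + a (Suc n) = (\<integral>\<omega>. indicator (U n) \<omega> * ?g \<omega> \<partial>M)"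
      unfolding a_def U_eq distrib_right using iN iH by simp
    also have "\<dots> \<le> (\<integral>\<omega>. indicator (U n) \<omega> * gauss_pos5 (p + S n \<omega>)
        (sqrt ((R (Suc n) \<omega>)\<^sup>2 + ((B (Suc n) \<omega> - A (Suc n) \<omega>) / 2)\<^sup>2)) \<partial>M)"
      using step(3)[of n] by (simp add: S_Suc add.assoc)
    \<comment> \<open>On \<open>U n\<close> the two integrands agree by \<open>RR\<close>; enlarging
      \<open>U n\<close> to \<open>N n\<close> adds only nonnegative values.\<close>
    also have "\<dots> \<le> a n"
      unfolding a_def
    proof (intro integral_mono step(2) conjunct1[OF Suc])
      fix \<omega>
      show "indicator (U n) \<omega> * gauss_pos5 (p + S n \<omega>)
        (sqrt ((R (Suc n) \<omega>)\<^sup>2 + ((B (Suc n) \<omega> - A (Suc n) \<omega>) / 2)\<^sup>2))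
        \<le> indicator (N n) \<omega> * gauss_pos5 (p + S n \<omega>) (R n \<omega>)"
        using UN[of n] RR[of \<omega> n] by (auto simp: indicator_def gauss_pos5_nonneg)
    qed
    also have "prob (T n) + a n \<le> gauss_pos5 p v" using Suc by simp
    finally show ?case using iN by simp
  qed
  \<comment> \<open>Continuity from below removes the finite horizon.\<close>
  have "(\<lambda>n. prob (T n)) \<longlonglongrightarrow> prob (\<Union>n. T n)"
    using sets_F[OF T_sets] by (intro finite_Lim_measure_incseq) (auto simp: incseq_def T_def, force)
  moreover have "prob (T n) \<le> gauss_pos5 p v" for n
  proof -
    have "0 \<le> a n" unfolding a_def by (intro Bochner_Integration.integral_nonneg) (simp add: gauss_pos5_nonneg)
    then show ?thesis using inv[of n] by linarith
  qed
  ultimately have "prob (\<Union>n. T n) \<le> gauss_pos5 p v"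
    by (intro LIMSEQ_le_const2) auto
  also have "(\<Union>n. T n) = {\<omega> \<in> space M. \<exists>n\<ge>1. 1 \<le> p + (\<Sum>i=1..n. X i \<omega>) \<and> (\<Sum>i=1..n. (B i \<omega> - A i \<omega>)\<^sup>2) \<le> 4 * v\<^sup>2}"
  proof -
    have "(\<Union>n. T n) = (\<Union>k\<in>{1..}. H k)"
      unfolding T_def by force
    then show ?thesis by (auto simp: H_def S_def Q_def)
  qed
  finally show ?thesis .
qed

theorem corollary3p2:
  fixes M :: "'a measure" and F :: "nat \<Rightarrow> 'a measure"
    and X A B :: "nat \<Rightarrow> 'a \<Rightarrow> real"
    and N :: "'b measure" and Z :: "'b \<Rightarrow> real"
    and x v :: real
  assumes "supermartingale_difference_sequence M F X"
    and "\<And>i. 1 \<le> i \<Longrightarrow> A i \<in> borel_measurable (F (i - 1))"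
    and "\<And>i. 1 \<le> i \<Longrightarrow> B i \<in> borel_measurable (F (i - 1))"
    and "\<And>i. 1 \<le> i \<Longrightarrow> AE \<omega> in M.
      cond_prob_on M (F (i - 1)) {\<omega>' \<in> space M. A i \<omega>' \<le> X i \<omega>' \<and> X i \<omega>' \<le> B i \<omega>'} \<omega> = 1"
    and "0 \<le> x" and "0 < v"
    and "prob_space N" and "distributed N lborel Z std_normal_density"
  shows "measure M {\<omega> \<in> space M. \<exists>n\<ge>1.
            x \<le> (\<Sum>i=1..n. X i \<omega>) \<and> (\<Sum>i=1..n. (B i \<omega> - A i \<omega>)\<^sup>2) \<le> 4 * v\<^sup>2}
         \<le> (INF l\<in>{0..}. \<integral>z. (pos_part (1 + l / 5 * (v * Z z - x))) ^ 5 \<partial>N)"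
proof (rule cINF_greatest)
  interpret sds: supermartingale_difference_sequence M F X by fact
  interpret N: prob_space N by fact
  fix l :: real assume "l \<in> {0..}"
  \<comment> \<open>The scaling factor. It may be 0, in which case the maximal inequality is applied
    with deviation 0.\<close>
  define q where "q = l / 5"
  have q: "0 \<le> q" using \<open>l \<in> {0..}\<close> by (simp add: q_def)
  have sub: "subalgebra M (F i)" for i
    using sds.sets_F_subset sds.space_F by (simp add: subalgebra_def)
  have A[measurable]: "A (Suc i) \<in> borel_measurable (F i)" and B[measurable]: "B (Suc i) \<in> borel_measurable (F i)" for i
    using assms(2,3)[of "Suc i"] by simp_all
  have bdd: "AE \<omega> in M. A (Suc i) \<omega> \<le> X (Suc i) \<omega> \<and> X (Suc i) \<omega> \<le> B (Suc i) \<omega>" for i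
  proof -
    have [measurable]: "A (Suc i) \<in> borel_measurable M" "B (Suc i) \<in> borel_measurable M" "X (Suc i) \<in> borel_measurable M"
      using measurable_from_subalg[OF sub A] measurable_from_subalg[OF sub B] sds.integrable_X by auto
    have "AE \<omega> in M. \<omega> \<in> {\<omega> \<in> space M. A (Suc i) \<omega> \<le> X (Suc i) \<omega> \<and> X (Suc i) \<omega> \<le> B (Suc i) \<omega>}"
      by (rule sds.AE_of_cond_prob_on_eq_1[OF sub[of i]]) (measurable, use assms(4)[of "Suc i"] in simp)
    then show ?thesis by eventually_elim simp
  qed
  have drift: "AE \<omega> in M. real_cond_exp M (F i) (\<lambda>\<omega>. q * X (Suc i) \<omega>) \<omega> \<le> 0" for i
  proof -
    interpret finite_measure_subalgebra M "F i" using sub by unfold_locales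
    have "AE \<omega> in M. real_cond_exp M (F i) (X (Suc i)) \<omega> \<le> 0"
      using sds.cond_exp_X_le_0[of "Suc i"] by simp
    with real_cond_exp_cmult[OF sds.integrable_X[of "Suc i"], of q] show ?thesis
      by eventually_elim (use q in \<open>simp add: mult_nonneg_nonpos\<close>)
  qed
  have "sds.prob {\<omega> \<in> space M. \<exists>n\<ge>1. 1 \<le> (1 - q * x) + (\<Sum>i=1..n. q * X i \<omega>) \<and>
      (\<Sum>i=1..n. (q * B i \<omega> - q * A i \<omega>)\<^sup>2) \<le> 4 * (q * v)\<^sup>2} \<le> gauss_pos5 (1 - q * x) (q * v)" (is "sds.prob ?E \<le> _")
  proof (rule sds.gauss_pos5_maximal[where F = F and X = "\<lambda>i \<omega>. q * X i \<omega>"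
        and A = "\<lambda>i \<omega>. q * A i \<omega>" and B = "\<lambda>i \<omega>. q * B i \<omega>"])
    show "AE \<omega> in M. q * A (Suc i) \<omega> \<le> q * X (Suc i) \<omega> \<and> q * X (Suc i) \<omega> \<le> q * B (Suc i) \<omega>" for i
      using bdd[of i] by eventually_elim (use q in \<open>auto intro: mult_left_mono\<close>)
    show "integrable M (\<lambda>\<omega>. q * X i \<omega>)" for i using sds.integrable_X[of i] by simp
    show "(\<lambda>\<omega>. q * X i \<omega>) \<in> borel_measurable (F i)" for i using sds.adapted_X[of i] by simp
    show "0 \<le> q * v" using q assms(6) by simp
  qed (use sub sds.sets_F_mono drift in simp_all)
  \<comment> \<open>Scaling gives an inclusion of events, and for \<open>q = 0\<close> possibly a
    strict one; the inclusion suffices.\<close>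
  moreover have "sds.prob {\<omega> \<in> space M. \<exists>n\<ge>1.
            x \<le> (\<Sum>i=1..n. X i \<omega>) \<and> (\<Sum>i=1..n. (B i \<omega> - A i \<omega>)\<^sup>2) \<le> 4 * v\<^sup>2} \<le> sds.prob ?E"
  proof (rule sds.finite_measure_mono)
    have *: "1 \<le> (1 - q * x) + (\<Sum>i=1..n. q * X i \<omega>) \<and>
      (\<Sum>i=1..n. (q * B i \<omega> - q * A i \<omega>)\<^sup>2) \<le> 4 * (q * v)\<^sup>2"
      if "x \<le> (\<Sum>i=1..n. X i \<omega>)" "(\<Sum>i=1..n. (B i \<omega> - A i \<omega>)\<^sup>2) \<le> 4 * v\<^sup>2" for n \<omega>
    proof
      show "1 \<le> (1 - q * x) + (\<Sum>i=1..n. q * X i \<omega>)"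
        using mult_left_mono[OF that(1) q] by (simp add: sum_distrib_left)
      show "(\<Sum>i=1..n. (q * B i \<omega> - q * A i \<omega>)\<^sup>2) \<le> 4 * (q * v)\<^sup>2"
        using mult_left_mono[OF that(2), of "q\<^sup>2"]
        by (simp add: sum_distrib_left[symmetric] right_diff_distrib[symmetric] power_mult_distrib mult.left_commute)
    qed
    then show "{\<omega> \<in> space M. \<exists>n\<ge>1.
            x \<le> (\<Sum>i=1..n. X i \<omega>) \<and> (\<Sum>i=1..n. (B i \<omega> - A i \<omega>)\<^sup>2) \<le> 4 * v\<^sup>2} \<subseteq> ?E"
      by blast
    have [measurable]: "X i \<in> borel_measurable M" for i using sds.integrable_X[of i] by simp
    have AB[measurable]: "A (Suc i) \<in> borel_measurable M" "B (Suc i) \<in> borel_measurable M" for i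
      using measurable_from_subalg[OF sub A] measurable_from_subalg[OF sub B] by auto
    \<comment> \<open>Measurability of the bounds is given from index 1 on, so each index of the sum
      is written as a successor.\<close>
    have [measurable]: "(\<lambda>\<omega>. \<Sum>i=1..n. (q * B i \<omega> - q * A i \<omega>)\<^sup>2) \<in> borel_measurable M" for n
    proof (intro borel_measurable_sum)
      fix i assume "i \<in> {1..n}"
      then obtain j where "i = Suc j" by (cases i) auto
      then show "(\<lambda>\<omega>. (q * B i \<omega> - q * A i \<omega>)\<^sup>2) \<in> borel_measurable M" by simp
    qed
    show "?E \<in> sets M" by measurable
  qed
  \<comment> \<open>The law of \<open>Z\<close> turns the integral against the density into an
    expectation over \<open>N\<close>.\<close>
  moreover have "gauss_pos5 (1 - q * x) (q * v) = (\<integral>z. (pos_part (1 + l / 5 * (v * Z z - x))) ^ 5 \<partial>N)"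
  proof -
    have eq: "1 - q * x + q * v * z = 1 + l / 5 * (v * z - x)" for z
      by (simp add: q_def right_diff_distrib mult.assoc)
    show ?thesis
      unfolding gauss_pos5_def eq by (rule distributed_integral[OF assms(8)]) simp_all
  qed
  ultimately show "measure M {\<omega> \<in> space M. \<exists>n\<ge>1.
            x \<le> (\<Sum>i=1..n. X i \<omega>) \<and> (\<Sum>i=1..n. (B i \<omega> - A i \<omega>)\<^sup>2) \<le> 4 * v\<^sup>2}
         \<le> (\<integral>z. (pos_part (1 + l / 5 * (v * Z z - x))) ^ 5 \<partial>N)"
    by linarith
qed simp

end
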